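(* Let $n,m,k$ be positive integers, let $X\in\mathbb{R}^{n\times n}$ be symmetric, let $\Lambda:\mathbb{R}^{n\times n}\to\mathbb{R}^{m\times m}$ be a linear map and $Y\in\mathbb{R}^{m\times m}$. Let $\xi$ be the optimal value of \[ \max_{\rho\in\mathbb{R}^{n\times n}}\ \operatorname{Tr}(X\rho)\quad\text{s.t.}\quad \Lambda(\rho)=Y,\ \operatorname{Tr}(\rho)=1,\ \rho\ge 0,\ \operatorname{rank}(\rho)\le k . \] For a positive integer $N$, let $\mathcal{H}_A=\cdots=\mathcal{H}_Z=\mathbb{R}^n\otimes\mathbb{R}^k$ be $N$ copies (parties $A,\dots,Z$), $\widetilde{X}=X\otimes\mathbb{1}_k$, $\widetilde{\Lambda}(\cdot)=\Lambda[\operatorname{Tr}_2(\cdot)]$ with $\operatorname{Tr}_2$ the partial trace over $\mathbb{R}^k$, and let $\xi_N$ be the optimal value of the semidefinite program over real symmetric matrices $\Phi_{AB\cdots Z}$ \[ \max\ \operatorname{Tr}\big[(\widetilde{X}_A\otimes\mathbb{1}_{B\cdots Z})\Phi_{AB\cdots Z}\big]\ \text{s.t.}\ \Phi_{AB\cdots Z}\ge0,\ \operatorname{Tr}(\Phi_{AB\cdots Z})=1,\ P_N^+\Phi_{AB\cdots Z}P_N^+=\Phi_{AB\cdots Z},\ \Phi_{AB\cdots Z}^{T_A}=\Phi_{AB\cdots Z}, \] \[ (\widetilde{\Lambda}_A\otimes\mathrm{id}_{B\cdots Z})(\Phi_{AB\cdots Z})=Y\otimes\operatorname{Tr}_A(\Phi_{AB\cdots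 Z}). \] Then $\xi\le\xi_N$ for every $N$, $\xi_{N+1}\le\xi_N$ for all $N$, and $\lim_{N\to+\infty}\xi_N=\xi$.
   Context: $P_N^+=\frac{1}{N!}\sum_{\sigma\in S_N}V_\sigma$ is the orthogonal projector onto the symmetric subspace of $(\mathbb{R}^n\otimes\mathbb{R}^k)^{\otimes N}$, where $V_\sigma$ permutes the $N$ tensor factors. $\Phi^{T_A}$ is the partial transpose on the first party with respect to the standard basis. A subscript $A$ indicates action on the first party, $\mathrm{id}_{B\cdots Z}$ the identity map on the remaining parties, $\operatorname{Tr}_A$ the partial trace over the first party. *)

theory Defs
  imports "HOL-Analysis.Analysis" "HOL-Combinatorics.Permutations"
begin

definition psd_mat :: "real^'n^'n \<Rightarrow> bool" where
  "psd_mat A \<longleftrightarrow> transpose A = A \<and> (\<forall>v. 0 \<le> v \<bullet> (A *v v))"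

text \<open>Matrices with rows/columns indexed by an explicit finite carrier I.\<close>
definition ctrace :: "'i set \<Rightarrow> ('i \<Rightarrow> 'i \<Rightarrow> real) \<Rightarrow> real" where
  "ctrace I M = (\<Sum>i\<in>I. M i i)"

definition cmult :: "'i set \<Rightarrow> ('i \<Rightarrow> 'i \<Rightarrow> real) \<Rightarrow> ('i \<Rightarrow> 'i \<Rightarrow> real) \<Rightarrow> ('i \<Rightarrow> 'i \<Rightarrow> real)" where
  "cmult I A B = (\<lambda>i j. \<Sum>l\<in>I. A i l * B l j)"

definition csym :: "'i set \<Rightarrow> ('i \<Rightarrow> 'i \<Rightarrow> real) \<Rightarrow> bool" where
  "csym I M \<longleftrightarrow> (\<forall>i\<in>I. \<forall>j\<in>I. M i j = M j i)"

definition cpsd :: "'i set \<Rightarrow> ('i \<Rightarrow> 'i \<Rightarrow> real) \<Rightarrow> bool" where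
  "cpsd I M \<longleftrightarrow> csym I M \<and> (\<forall>v. 0 \<le> (\<Sum>i\<in>I. \<Sum>j\<in>I. v i * M i j * v j))"

definition ceq :: "'i set \<Rightarrow> ('i \<Rightarrow> 'i \<Rightarrow> real) \<Rightarrow> ('i \<Rightarrow> 'i \<Rightarrow> real) \<Rightarrow> bool" where
  "ceq I A B \<longleftrightarrow> (\<forall>i\<in>I. \<forall>j\<in>I. A i j = B i j)"

text \<open>Basis of (R^n \<otimes> R^k)^{\<otimes>N}: lists of length N of single-party indices;
  the head of the list is party A, the tail is parties B..Z.\<close>
definition tuples :: "nat \<Rightarrow> 'a list set" where
  "tuples N = {xs. length xs = N}"

text \<open>Symmetric projector P_N^+ = (1/N!) sum over sigma of V_sigma.\<close>
definition sym_proj :: "nat \<Rightarrow> 'a list \<Rightarrow> 'a list \<Rightarrow> real" where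
  "sym_proj N xs ys =
     real (card {\<sigma>. \<sigma> permutes {..<N} \<and> xs = permute_list \<sigma> ys}) / fact N"

definition ptranspose_A :: "('a list \<Rightarrow> 'a list \<Rightarrow> real) \<Rightarrow> ('a list \<Rightarrow> 'a list \<Rightarrow> real)" where
  "ptranspose_A \<Phi> = (\<lambda>xs ys. \<Phi> (hd ys # tl xs) (hd xs # tl ys))"

definition tensor_id :: "real^'n^'n \<Rightarrow> ('n \<times> 'k) \<Rightarrow> ('n \<times> 'k) \<Rightarrow> real" where
  "tensor_id X = (\<lambda>(i,a) (j,b). X $ i $ j * (if a = b then 1 else 0))"

definition op_A_id :: "('a \<Rightarrow> 'a \<Rightarrow> real) \<Rightarrow> ('a list \<Rightarrow> 'a list \<Rightarrow> real)" where
  "op_A_id M = (\<lambda>xs ys. M (hd xs) (hd ys) * (if tl xs = tl ys then 1 else 0))"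

definition ptrace2 :: "(('n::finite \<times> 'k::finite) \<Rightarrow> ('n \<times> 'k) \<Rightarrow> real) \<Rightarrow> real^'n^'n" where
  "ptrace2 M = (\<chi> i j. \<Sum>a\<in>UNIV. M (i,a) (j,a))"

definition LambdaT_A_id ::
  "(real^'n^'n \<Rightarrow> real^'m^'m) \<Rightarrow> (('n::finite \<times> 'k::finite) list \<Rightarrow> ('n \<times> 'k) list \<Rightarrow> real)
    \<Rightarrow> ('m \<times> ('n \<times> 'k) list) \<Rightarrow> ('m \<times> ('n \<times> 'k) list) \<Rightarrow> real" where
  "LambdaT_A_id \<Lambda> \<Phi> = (\<lambda>(\<mu>, s) (\<nu>, t). \<Lambda> (ptrace2 (\<lambda>p q. \<Phi> (p # s) (q # t))) $ \<mu> $ \<nu>)"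

definition Y_tensor_TrA ::
  "real^'m^'m \<Rightarrow> ('a::finite list \<Rightarrow> 'a list \<Rightarrow> real)
    \<Rightarrow> ('m \<times> 'a list) \<Rightarrow> ('m \<times> 'a list) \<Rightarrow> real" where
  "Y_tensor_TrA Y \<Phi> = (\<lambda>(\<mu>, s) (\<nu>, t). Y $ \<mu> $ \<nu> * (\<Sum>p\<in>UNIV. \<Phi> (p # s) (p # t)))"

text \<open>Optimal value xi of the rank-constrained problem (ereal; Sup {} = -\<infinity>).\<close>
definition xi_opt :: "real^'n^'n \<Rightarrow> (real^'n^'n \<Rightarrow> real^'m^'m) \<Rightarrow> real^'m^'m \<Rightarrow> nat \<Rightarrow> ereal" where
  "xi_opt X \<Lambda> Y k = Sup {ereal (trace (X ** \<rho>)) | \<rho>.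
      \<Lambda> \<rho> = Y \<and> trace \<rho> = 1 \<and> psd_mat \<rho> \<and> rank \<rho> \<le> k}"

text \<open>Optimal value xi_N of the N-party SDP; the type 'k indexes R^k.\<close>
definition xi_N :: "real^'n^'n \<Rightarrow> (real^'n^'n \<Rightarrow> real^'m^'m) \<Rightarrow> real^'m^'m \<Rightarrow> 'k::finite itself
    \<Rightarrow> nat \<Rightarrow> ereal" where
  "xi_N X \<Lambda> Y _ N = Sup {ereal (ctrace (tuples N)
        (cmult (tuples N) (op_A_id (tensor_id X :: ('n \<times> 'k) \<Rightarrow> _)) \<Phi>)) | \<Phi>.
      csym (tuples N) \<Phi> \<and>
      cpsd (tuples N) \<Phi> \<and>
      ctrace (tuples N) \<Phi> = 1 \<and>
      ceq (tuples N) (cmult (tuples N) (cmult (tuples N) (sym_proj N) \<Phi>) (sym_proj N)) \<Phi> \<and>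
      ceq (tuples N) (ptranspose_A \<Phi>) \<Phi> \<and>
      ceq (UNIV \<times> tuples (N - 1)) (LambdaT_A_id \<Lambda> \<Phi>) (Y_tensor_TrA Y \<Phi>)}"

end

theory Submission
  imports Defs
begin

text \<open>
  Symmetry under \<open>P\<^sub>N\<^sup>+\<close> together with invariance under partial transposition makes a feasible
  \<open>\<Phi>\<close> totally symmetric in all its \<open>2N\<close> indices, so it is a linear functional on forms of degree
  \<open>2N\<close> that is nonnegative on squares and normalised on \<open>|x|\<^sup>2\<^sup>N\<close>: a truncated moment functional
  on the unit sphere. Only its quadratic marginal \<open>G\<close> enters the objective. The sets of marginals
  are convex, bounded and decrease with \<open>N\<close>; let \<open>K\<close> be the intersection of their closures.
  Maximise the objective over \<open>K\<close> at an extreme point \<open>G\<close>. Multiplying approximating functionals by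
  \<open>1 \<plusminus> x\<^sub>i x\<^sub>j / 2\<close> writes \<open>G\<close> as a convex combination of two points of \<open>K\<close>, which must both equal
  \<open>G\<close>; hence the fourth moments converge to \<open>G\<^sub>i\<^sub>j G\<^sub>k\<^sub>l\<close>, and their total symmetry forces
  \<open>G = y y\<^sup>T\<close>. The reduced matrix of \<open>y\<close> is then feasible for the rank-constrained problem.
\<close>

section \<open>Sums over index tuples\<close>

lemma finite_tuples [simp]: "finite (tuples N :: 'a::finite list set)"
  unfolding tuples_def using finite_lists_length_eq[of "UNIV :: 'a set" N] by simp

lemma sum_tuples_0: "(\<Sum>s\<in>tuples 0. g s) = g []"
  by (simp add: tuples_def)

lemma sum_tuples_Suc:
  fixes g :: "'a::finite list \<Rightarrow> 'b::comm_monoid_add"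
  shows "(\<Sum>s\<in>tuples (Suc N). g s) = (\<Sum>p\<in>UNIV. \<Sum>s\<in>tuples N. g (p # s))"
proof -
  have "tuples (Suc N) = (\<lambda>(p::'a, s). p # s) ` (UNIV \<times> tuples N)"
    by (auto simp: tuples_def length_Suc_conv image_iff)
  moreover have "inj_on (\<lambda>(p::'a, s). p # s) (UNIV \<times> tuples N)"
    by (auto simp: inj_on_def)
  ultimately show ?thesis
    by (simp add: sum.reindex sum.cartesian_product case_prod_unfold)
qed

section \<open>Moment functionals\<close>

text \<open>
  A function on multisets of indices is read as a linear functional on forms: the multiset
  stands for the monomial, so \<open>\<phi> (M + N)\<close> is the functional applied to a product.
  Level \<open>n\<close> below corresponds to \<open>N = n + 1\<close> parties.
\<close>

definition slice :: "('a multiset \<Rightarrow> real) \<Rightarrow> 'a multiset \<Rightarrow> real^('a::finite \<times> 'a)" where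
  "slice \<phi> M = (\<chi> pq. \<phi> (M + {#fst pq, snd pq#}))"

text \<open>A vector \<open>v\<close> on lists represents a form of degree \<open>n + 1\<close>;
  lists with equal multisets are the same monomial, so the first clause is nonnegativity on squares.
  The second is the linear constraint tested against every monomial of degree \<open>2 * n\<close>.
  For linear \<open>C\<close> the two conditions define a convex cone.\<close>

definition moment_form ::
  "(real^('a::finite \<times> 'a) \<Rightarrow> 'b::real_normed_vector) \<Rightarrow> nat \<Rightarrow> ('a multiset \<Rightarrow> real) \<Rightarrow> bool" where
  "moment_form C n \<phi> \<longleftrightarrow>
     (\<forall>v. 0 \<le> (\<Sum>s\<in>tuples (Suc n). \<Sum>t\<in>tuples (Suc n). v s * \<phi> (mset s + mset t) * v t)) \<and>
     (\<forall>M. size M = 2 * n \<longrightarrow> C (slice \<phi> M) = 0)"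

text \<open>The sum over \<open>mset s + mset s\<close> is multiplication by
  \<open>|x|^(2 n)\<close>; in tensor language it is the partial trace over all parties but
  one.\<close>

definition marginal :: "nat \<Rightarrow> ('a multiset \<Rightarrow> real) \<Rightarrow> real^('a::finite \<times> 'a)" where
  "marginal n \<phi> = (\<Sum>s\<in>tuples n. slice \<phi> (mset s + mset s))"

definition diag_sum :: "real^('a::finite \<times> 'a) \<Rightarrow> real" where
  "diag_sum G = (\<Sum>p\<in>UNIV. G $ (p, p))"

definition marginals ::
  "(real^('a::finite \<times> 'a) \<Rightarrow> 'b::real_normed_vector) \<Rightarrow> nat \<Rightarrow> (real^('a \<times> 'a)) set" where
  "marginals C n = {marginal n \<phi> | \<phi>. moment_form C n \<phi> \<and> diag_sum (marginal n \<phi>) = 1}"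

lemma linear_diag_sum: "linear diag_sum"
  by (rule linearI) (auto simp: diag_sum_def sum.distrib sum_distrib_left)

lemma marginal_nth:
  "marginal n \<phi> $ (p, q) = (\<Sum>s\<in>tuples n. \<phi> (mset s + mset s + {#p, q#}))"
  by (simp add: marginal_def slice_def)

lemma marginal_commute: "marginal n \<phi> $ (p, q) = marginal n \<phi> $ (q, p)"
  by (simp add: marginal_nth add_mset_commute)

lemma moment_form_combine:
  assumes "linear C" "moment_form C n \<phi>" "moment_form C n \<psi>" "0 \<le> a" "0 \<le> b"
  shows "moment_form C n (\<lambda>M. a * \<phi> M + b * \<psi> M)"
proof -
  have "(\<Sum>s\<in>tuples (Suc n). \<Sum>t\<in>tuples (Suc n). v s * (a * \<phi> (mset s + mset t) + b * \<psi> (mset s + mset t)) * v t)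
    = a * (\<Sum>s\<in>tuples (Suc n). \<Sum>t\<in>tuples (Suc n). v s * \<phi> (mset s + mset t) * v t)
    + b * (\<Sum>s\<in>tuples (Suc n). \<Sum>t\<in>tuples (Suc n). v s * \<psi> (mset s + mset t) * v t)" for v
    by (simp add: sum_distrib_left sum.distrib[symmetric] algebra_simps)
  moreover have "slice (\<lambda>M. a * \<phi> M + b * \<psi> M) M = a *\<^sub>R slice \<phi> M + b *\<^sub>R slice \<psi> M" for M
    by (simp add: slice_def vec_eq_iff)
  ultimately show ?thesis
    using assms by (simp add: moment_form_def linear_add linear_scale)
qed

lemma marginal_combine:
  "marginal n (\<lambda>M. a * \<phi> M + b * \<psi> M) = a *\<^sub>R marginal n \<phi> + b *\<^sub>R marginal n \<psi>"
  by (simp add: vec_eq_iff marginal_nth sum.distrib sum_distrib_left)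

lemma convex_marginals:
  assumes "linear C" shows "convex (marginals C n)"
proof (rule convexI)
  fix x y and u v :: real
  assume "x \<in> marginals C n" "y \<in> marginals C n" and uv: "0 \<le> u" "0 \<le> v" "u + v = 1"
  then obtain \<phi> \<psi> where *: "x = marginal n \<phi>" "moment_form C n \<phi>" "diag_sum x = 1"
    "y = marginal n \<psi>" "moment_form C n \<psi>" "diag_sum y = 1"
    by (auto simp: marginals_def)
  have "diag_sum (u *\<^sub>R x + v *\<^sub>R y) = 1"
    using * uv by (simp add: linear_diag_sum linear_add linear_scale)
  then show "u *\<^sub>R x + v *\<^sub>R y \<in> marginals C n"
    unfolding marginals_def using * uv moment_form_combine[OF assms, of n \<phi> \<psi> u v]
    by (auto simp: marginal_combine intro!: exI[of _ "\<lambda>M. u * \<phi> M + v * \<psi> M"])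
qed

lemma marginals_scale_in:
  assumes "linear C" "moment_form C n \<phi>" "0 < diag_sum (marginal n \<phi>)"
  shows "inverse (diag_sum (marginal n \<phi>)) *\<^sub>R marginal n \<phi> \<in> marginals C n"
proof -
  let ?c = "inverse (diag_sum (marginal n \<phi>))"
  have "moment_form C n (\<lambda>M. ?c * \<phi> M + 0 * \<phi> M)"
    using assms by (intro moment_form_combine) auto
  moreover have "marginal n (\<lambda>M. ?c * \<phi> M + 0 * \<phi> M) = ?c *\<^sub>R marginal n \<phi>"
    by (subst marginal_combine) simp
  moreover have "diag_sum (?c *\<^sub>R marginal n \<phi>) = 1"
    using assms(3) by (simp add: linear_diag_sum linear_scale)
  ultimately show ?thesis
    unfolding marginals_def by (smt (verit) mem_Collect_eq)
qed

text \<open>Positivity on the square of a linear form \<open>u\<close> times a form \<open>v\<close>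
  of degree \<open>n\<close>. For fixed \<open>v\<close> the inner double sum is thus a positive
  semidefinite matrix in \<open>p\<close>, \<open>q\<close>.\<close>

lemma moment_form_product:
  assumes "moment_form C n \<phi>"
  shows "0 \<le> (\<Sum>p\<in>UNIV. \<Sum>q\<in>UNIV. u p * u q *
    (\<Sum>s\<in>tuples n. \<Sum>t\<in>tuples n. v s * \<phi> (mset s + mset t + {#p, q#}) * v t))"
proof -
  have "0 \<le> (\<Sum>s\<in>tuples (Suc n). \<Sum>t\<in>tuples (Suc n).
      (u (hd s) * v (tl s)) * \<phi> (mset s + mset t) * (u (hd t) * v (tl t)))"
    by (rule conjunct1[OF assms[unfolded moment_form_def], THEN spec])
  also have "\<dots> = (\<Sum>p\<in>UNIV. \<Sum>s\<in>tuples n. \<Sum>q\<in>UNIV. \<Sum>t\<in>tuples n.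
      u p * u q * (v s * \<phi> (mset s + mset t + {#p, q#}) * v t))"
    by (simp add: sum_tuples_Suc mult_ac add_mset_commute)
  also have "\<dots> = (\<Sum>p\<in>UNIV. \<Sum>q\<in>UNIV. \<Sum>s\<in>tuples n. \<Sum>t\<in>tuples n.
      u p * u q * (v s * \<phi> (mset s + mset t + {#p, q#}) * v t))"
    by (rule sum.cong[OF refl]) (rule sum.swap)
  finally show ?thesis by (simp add: sum_distrib_left)
qed

text \<open>Testing on \<open>e_i + e_j\<close> and \<open>e_i - e_j\<close> gives
  \<open>2 |Q i j| <= Q i i + Q j j\<close>, and the diagonal entries, being nonnegative, are each
  at most the trace.\<close>

lemma quadratic_form_entry_bound:
  fixes Q :: "'a::finite \<Rightarrow> 'a \<Rightarrow> real"
  assumes psd: "\<And>u. 0 \<le> (\<Sum>p\<in>UNIV. \<Sum>q\<in>UNIV. u p * u q * Q p q)"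
    and sym: "\<And>p q. Q p q = Q q p"
  shows "\<bar>Q i j\<bar> \<le> (\<Sum>p\<in>UNIV. Q p p)"
proof -
  \<comment> \<open>Sums of indicators instead of a case split keep the computation valid for
    \<open>i = j\<close>.\<close>
  have one: "(\<Sum>q\<in>UNIV. (\<alpha> * of_bool (q = i) + \<beta> * of_bool (q = j)) * g q) = \<alpha> * g i + \<beta> * g j"
    for \<alpha> \<beta> i j and g :: "'a \<Rightarrow> real"
  proof -
    have "(\<alpha> * of_bool (q = i) + \<beta> * of_bool (q = j)) * g q
        = (if q = i then \<alpha> * g q else 0) + (if q = j then \<beta> * g q else 0)" for q
      by (simp add: distrib_right)
    then show ?thesis by (simp add: sum.distrib)
  qed
  have two: "(\<Sum>p\<in>UNIV. \<Sum>q\<in>UNIV. (\<alpha> * of_bool (p = i) + \<beta> * of_bool (p = j)) *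
      (\<alpha> * of_bool (q = i) + \<beta> * of_bool (q = j)) * Q p q)
     = \<alpha>\<^sup>2 * Q i i + 2 * \<alpha> * \<beta> * Q i j + \<beta>\<^sup>2 * Q j j" for \<alpha> \<beta> i j
    unfolding mult.assoc sum_distrib_left[symmetric] one
    using sym[of i j] by (simp add: algebra_simps power2_eq_square)
  have nn: "0 \<le> Q p p" for p
    using psd[of "\<lambda>q. 1 * of_bool (q = p) + 0 * of_bool (q = p)"] unfolding two by simp
  have pos: "\<bar>2 * Q i j\<bar> \<le> Q i i + Q j j"
    using psd[of "\<lambda>q. 1 * of_bool (q = i) + 1 * of_bool (q = j)"]
      psd[of "\<lambda>q. 1 * of_bool (q = i) + (-1) * of_bool (q = j)"] unfolding two by simp
  have le: "Q p p \<le> (\<Sum>p\<in>UNIV. Q p p)" for p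
    by (rule member_le_sum) (auto simp: nn)
  show ?thesis using pos le[of i] le[of j] by simp
qed

text \<open>The marginal is the sum over tuples \<open>r\<close> of the positive semidefinite
  matrices of \<open>moment_form_product\<close>, with \<open>v\<close> the indicator of
  \<open>r\<close>; its trace therefore dominates its entries.\<close>

lemma marginal_bound:
  assumes "moment_form C n \<phi>"
  shows "\<bar>marginal n \<phi> $ (i, j)\<bar> \<le> diag_sum (marginal n \<phi>)"
  unfolding diag_sum_def
proof (rule quadratic_form_entry_bound[of "\<lambda>p q. marginal n \<phi> $ (p, q)"])
  show "marginal n \<phi> $ (p, q) = marginal n \<phi> $ (q, p)" for p q
    by (rule marginal_commute)
  fix u :: "'a \<Rightarrow> real"
  have "0 \<le> (\<Sum>r\<in>tuples n. \<Sum>p\<in>UNIV. \<Sum>q\<in>UNIV. u p * u q *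
    (\<Sum>s\<in>tuples n. \<Sum>t\<in>tuples n. of_bool (s = r) * \<phi> (mset s + mset t + {#p, q#}) * of_bool (t = r)))"
    by (intro sum_nonneg moment_form_product[OF assms])
  also have "\<dots> = (\<Sum>r\<in>tuples n. \<Sum>p\<in>UNIV. \<Sum>q\<in>UNIV. u p * u q * \<phi> (mset r + mset r + {#p, q#}))"
    by (intro sum.cong refl) (simp add: of_bool_def if_distrib[of "\<lambda>x. x * _"]
        if_distrib[of "\<lambda>x. _ * x"] cong: if_cong)
  also have "\<dots> = (\<Sum>p\<in>UNIV. \<Sum>q\<in>UNIV. u p * u q * marginal n \<phi> $ (p, q))"
    unfolding marginal_nth sum_distrib_left
    by (subst sum.swap, rule sum.cong[OF refl], subst sum.swap, rule refl)
  finally show "0 \<le> (\<Sum>p\<in>UNIV. \<Sum>q\<in>UNIV. u p * u q * marginal n \<phi> $ (p, q))" .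
qed

lemma bounded_marginals: "bounded (marginals C n)"
proof -
  have "norm G \<le> (\<Sum>x\<in>(UNIV :: ('a \<times> 'a) set). 1)" if "G \<in> marginals C n" for G :: "real^('a \<times> 'a)"
  proof -
    have "\<bar>G $ x\<bar> \<le> 1" for x
      using that marginal_bound[of C n _ "fst x" "snd x"] unfolding marginals_def by force
    then show ?thesis
      by (intro order_trans[OF norm_le_l1_cart] sum_mono)
  qed
  then show ?thesis unfolding bounded_iff by blast
qed

section \<open>Tilting: multiplying functionals by the quadratic form
  \<open>|x|^2 + e x_i x_j\<close>\<close>

definition tilt :: "real \<Rightarrow> 'a::finite \<Rightarrow> 'a \<Rightarrow> ('a multiset \<Rightarrow> real) \<Rightarrow> 'a multiset \<Rightarrow> real" where
  "tilt e i j \<phi> M = (\<Sum>p\<in>UNIV. \<phi> (M + {#p, p#})) + e * \<phi> (M + {#i, j#})"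

text \<open>A functional of level \<open>n + 1\<close> acts in degree \<open>2 n + 4\<close>, which
  leaves the factor \<open>|x|^(2 n)\<close> next to four indices. Grouping these in pairs makes
  each row a vector of the same space as the marginals.\<close>

definition fourth_moments :: "nat \<Rightarrow> ('a multiset \<Rightarrow> real) \<Rightarrow> real^(('a::finite \<times> 'a) \<times> ('a \<times> 'a))" where
  "fourth_moments n \<phi> = (\<chi> x. \<Sum>s\<in>tuples n.
     \<phi> (mset s + mset s + {#fst (fst x), snd (fst x), fst (snd x), snd (snd x)#}))"

text \<open>For fixed \<open>v\<close> the positive semidefinite matrix \<open>Q\<close> has entries
  bounded by its trace, so the weight \<open>|x|^2 + e x_i x_j\<close> preserves positivity for
  \<open>|e| <= 1\<close>. The constraint survives because the extra factor only enlarges the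
  monomials it is tested against.\<close>

lemma moment_form_tilt:
  assumes C: "linear C" and \<phi>: "moment_form C (Suc n) \<phi>" and e: "\<bar>e\<bar> \<le> 1"
  shows "moment_form C n (tilt e i j \<phi>)"
  unfolding moment_form_def
proof (intro conjI allI impI)
  fix v :: "'a list \<Rightarrow> real"
  define Q where "Q = (\<lambda>p q. \<Sum>s\<in>tuples (Suc n). \<Sum>t\<in>tuples (Suc n).
      v s * \<phi> (mset s + mset t + {#p, q#}) * v t)"
  have "\<bar>Q i j\<bar> \<le> (\<Sum>p\<in>UNIV. Q p p)"
  proof (rule quadratic_form_entry_bound)
    show "0 \<le> (\<Sum>p\<in>UNIV. \<Sum>q\<in>UNIV. u p * u q * Q p q)" for u
      unfolding Q_def by (rule moment_form_product[OF \<phi>])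
    show "Q p q = Q q p" for p q
      by (simp add: Q_def add_mset_commute)
  qed
  moreover have "\<bar>e * Q i j\<bar> \<le> 1 * \<bar>Q i j\<bar>"
    unfolding abs_mult using e by (intro mult_right_mono) auto
  ultimately have "0 \<le> (\<Sum>p\<in>UNIV. Q p p) + e * Q i j" by linarith
  also have "(\<Sum>p\<in>UNIV. Q p p) = (\<Sum>s\<in>tuples (Suc n). \<Sum>t\<in>tuples (Suc n). \<Sum>p\<in>UNIV.
      v s * \<phi> (mset s + mset t + {#p, p#}) * v t)"
    unfolding Q_def by (subst sum.swap, rule sum.cong[OF refl], subst sum.swap, rule refl)
  also have "\<dots> + e * Q i j = (\<Sum>s\<in>tuples (Suc n). \<Sum>t\<in>tuples (Suc n).
      v s * tilt e i j \<phi> (mset s + mset t) * v t)"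
    by (simp add: Q_def tilt_def sum_distrib_left sum_distrib_right sum.distrib[symmetric] algebra_simps)
  finally show "0 \<le> (\<Sum>s\<in>tuples (Suc n). \<Sum>t\<in>tuples (Suc n). v s * tilt e i j \<phi> (mset s + mset t) * v t)" .
next
  fix M :: "'a multiset" assume M: "size M = 2 * n"
  have "slice (tilt e i j \<phi>) M = (\<Sum>p\<in>UNIV. slice \<phi> (M + {#p, p#})) + e *\<^sub>R slice \<phi> (M + {#i, j#})"
    by (simp add: vec_eq_iff slice_def tilt_def add_mset_commute)
  also have "C \<dots> = (\<Sum>p\<in>UNIV. C (slice \<phi> (M + {#p, p#}))) + e *\<^sub>R C (slice \<phi> (M + {#i, j#}))"
    using C by (simp add: linear_add linear_scale linear_sum)
  also have "\<dots> = 0" using \<phi> M by (simp add: moment_form_def)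
  finally show "C (slice (tilt e i j \<phi>) M) = 0" .
qed

lemma marginal_tilt:
  "marginal n (tilt e i j \<phi>) $ (p, q)
     = marginal (Suc n) \<phi> $ (p, q) + e * fourth_moments n \<phi> $ ((i, j), (p, q))"
proof -
  have "(\<Sum>s\<in>tuples n. \<Sum>r\<in>UNIV. \<phi> (add_mset p (add_mset q (add_mset r (add_mset r (mset s + mset s)))))) =
    (\<Sum>r\<in>UNIV. \<Sum>s\<in>tuples n. \<phi> (add_mset r (add_mset r (add_mset p (add_mset q (mset s + mset s))))))"
    by (subst sum.swap) (simp add: add_mset_commute)
  then show ?thesis
    by (simp add: marginal_nth tilt_def fourth_moments_def sum.distrib sum_distrib_left
        sum_tuples_Suc add_mset_commute)
qed

text \<open>Contracting one index pair of the fourth moments restores a factor \<open>|x|^2\<close>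
  and returns the second moments.\<close>

lemma diag_sum_marginal_tilt:
  "diag_sum (marginal n (tilt e i j \<phi>))
     = diag_sum (marginal (Suc n) \<phi>) + e * marginal (Suc n) \<phi> $ (i, j)"
proof -
  have "(\<Sum>p\<in>UNIV. fourth_moments n \<phi> $ ((i, j), (p, p))) = marginal (Suc n) \<phi> $ (i, j)"
    by (simp add: fourth_moments_def marginal_nth sum_tuples_Suc add_mset_commute)
  then show ?thesis
    by (simp add: diag_sum_def marginal_tilt sum.distrib sum_distrib_left[symmetric])
qed

text \<open>Multiplication by \<open>|x|^2\<close> lowers the level without changing the marginal;
  it corresponds to tracing out one party.\<close>

lemma marginals_antimono:
  assumes "linear C" shows "marginals C (Suc n) \<subseteq> marginals C n"
proof
  fix G assume "G \<in> marginals C (Suc n)"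
  then obtain \<phi> where \<phi>: "G = marginal (Suc n) \<phi>" "moment_form C (Suc n) \<phi>" "diag_sum G = 1"
    by (auto simp: marginals_def)
  \<comment> \<open>The tilt with \<open>e = 0\<close> is this multiplication, whatever the two
    indices are.\<close>
  have "G = marginal n (tilt 0 undefined undefined \<phi>)"
    by (simp add: \<phi>(1) vec_eq_iff marginal_tilt split_paired_all)
  then show "G \<in> marginals C n"
    using moment_form_tilt[OF assms \<phi>(2), of 0 undefined undefined] \<phi>(3)
    by (auto simp: marginals_def)
qed

section \<open>The limiting set of marginals and its extreme points\<close>

definition limit_marginals ::
  "(real^('a::finite \<times> 'a) \<Rightarrow> 'b::real_normed_vector) \<Rightarrow> (real^('a \<times> 'a)) set" where
  "limit_marginals C = (\<Inter>n. closure (marginals C n))"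

lemma marginals_le:
  assumes "linear C" "m \<le> n" shows "marginals C n \<subseteq> marginals C m"
  using lift_Suc_antimono_le[of "marginals C"] marginals_antimono[OF assms(1)] assms(2) by blast

lemma convex_limit_marginals: "linear C \<Longrightarrow> convex (limit_marginals C)"
  unfolding limit_marginals_def by (intro convex_INT convex_closure convex_marginals)

text \<open>Passing to closures makes boundedness the only input to compactness.\<close>

lemma compact_closure_marginals: "compact (closure (marginals C n))"
  by (simp add: bounded_marginals compact_closure)

lemma compact_limit_marginals: "compact (limit_marginals C)"
proof -
  have "limit_marginals C = closure (marginals C 0) \<inter> limit_marginals C"
    by (auto simp: limit_marginals_def)
  moreover have "closed (limit_marginals C)"
    unfolding limit_marginals_def by (intro closed_INT) auto
  ultimately show ?thesis
    by (metis compact_Int_closed compact_closure_marginals)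
qed

text \<open>Entries of a normalised marginal are at most 1 in absolute value, so
  \<open>|e| <= 1/2\<close> keeps the normaliser at least \<open>1/2\<close> and the tilt can be
  renormalised.\<close>

lemma marginals_tilt:
  assumes C: "linear C" and \<phi>: "moment_form C (Suc n) \<phi>"
    and tr: "diag_sum (marginal (Suc n) \<phi>) = 1" and e: "\<bar>e\<bar> \<le> 1 / 2"
  shows "inverse (1 + e * marginal (Suc n) \<phi> $ (i, j)) *\<^sub>R
    (marginal (Suc n) \<phi> + e *\<^sub>R (\<chi> x. fourth_moments n \<phi> $ ((i, j), x))) \<in> marginals C n"
proof -
  have "marginal n (tilt e i j \<phi>) = marginal (Suc n) \<phi> + e *\<^sub>R (\<chi> x. fourth_moments n \<phi> $ ((i, j), x))"
    by (simp add: vec_eq_iff split_paired_all marginal_tilt)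
  moreover have "diag_sum (marginal n (tilt e i j \<phi>)) = 1 + e * marginal (Suc n) \<phi> $ (i, j)"
    by (simp add: diag_sum_marginal_tilt tr)
  moreover have "\<bar>e * marginal (Suc n) \<phi> $ (i, j)\<bar> \<le> (1/2) * 1"
    unfolding abs_mult using e marginal_bound[OF \<phi>, of i j] tr by (intro mult_mono) auto
  ultimately show ?thesis
    using marginals_scale_in[OF C moment_form_tilt[OF C \<phi>], of e i j] e by auto
qed

text \<open>With \<open>m\<close> the marginal and \<open>F\<close> the fourth moment,
  \<open>marginal_bound\<close> for the tilt with \<open>e = 1\<close> gives
  \<open>|m_pq + F| <= 1 + m_ij <= 2\<close>; then \<open>|m_pq| <= 1\<close> yields 3.\<close>

lemma fourth_moments_bound:
  assumes C: "linear C" and \<phi>: "moment_form C (Suc n) \<phi>"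
    and tr: "diag_sum (marginal (Suc n) \<phi>) = 1"
  shows "\<bar>fourth_moments n \<phi> $ x\<bar> \<le> 3"
proof -
  obtain i j p q where x: "x = ((i, j), (p, q))" by (metis surj_pair)
  have "\<bar>marginal n (tilt 1 i j \<phi>) $ (p, q)\<bar> \<le> diag_sum (marginal n (tilt 1 i j \<phi>))"
    using moment_form_tilt[OF C \<phi>] by (intro marginal_bound[of C]) auto
  then show ?thesis
    using marginal_bound[OF \<phi>, of i j] marginal_bound[OF \<phi>, of p q]
    by (simp add: x marginal_tilt diag_sum_marginal_tilt tr)
qed

lemma fourth_moments_swap:
  "fourth_moments n \<phi> $ ((i, j), (k, l)) = fourth_moments n \<phi> $ ((i, k), (j, l))"
  by (simp add: fourth_moments_def add_mset_commute)

text \<open>Reweighting by \<open>1 + e x_i x_j\<close> cannot move an extreme \<open>G\<close>, so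
  the limiting fourth moments factor as \<open>G_ij G_kl\<close>. Their symmetry under exchanging
  indices then gives the identity.\<close>

lemma extreme_limit_marginal_multiplicative:
  assumes C: "linear C" and ext: "G extreme_point_of limit_marginals C"
  shows "G $ (i, j) * G $ (k, l) = G $ (i, k) * G $ (j, l)"
proof -
  \<comment> \<open>Approximants are taken at level \<open>Suc n\<close>, one up, so that their
    tilts live at level \<open>n\<close>.\<close>
  have "\<exists>\<phi>. moment_form C (Suc n) \<phi> \<and> diag_sum (marginal (Suc n) \<phi>) = 1 \<and>
      dist (marginal (Suc n) \<phi>) G < inverse (real (Suc n))" (is "\<exists>\<phi>. ?P n \<phi>") for n
  proof -
    have "G \<in> closure (marginals C (Suc n))"
      using ext by (auto simp: extreme_point_of_def limit_marginals_def)
    then have "\<exists>H\<in>marginals C (Suc n). dist H G < inverse (real (Suc n))"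
      unfolding closure_approachable by (elim allE[of _ "inverse (real (Suc n))"]) simp
    then show ?thesis by (auto simp: marginals_def)
  qed
  then have "\<forall>n. \<exists>\<phi>. ?P n \<phi>" by blast
  from choice[OF this] obtain \<phi> where \<phi>: "\<And>n. moment_form C (Suc n) (\<phi> n)"
    and tr: "\<And>n. diag_sum (marginal (Suc n) (\<phi> n)) = 1"
    and dist: "\<And>n. dist (marginal (Suc n) (\<phi> n)) G < inverse (real (Suc n))"
    by blast
  define g where "g n = marginal (Suc n) (\<phi> n)" for n
  define F where "F n = fourth_moments n (\<phi> n)" for n
  have "(\<lambda>n. dist (g n) G) \<longlonglongrightarrow> 0"
  proof (rule real_tendsto_sandwich[OF _ _ tendsto_const LIMSEQ_inverse_real_of_nat])
    show "\<forall>\<^sub>F n in sequentially. 0 \<le> dist (g n) G" by simp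
    show "\<forall>\<^sub>F n in sequentially. dist (g n) G \<le> inverse (real (Suc n))"
      unfolding g_def by (rule always_eventually, rule allI, rule less_imp_le, rule dist)
  qed
  then have gG: "g \<longlonglongrightarrow> G" by (subst tendsto_dist_iff)
  have "norm (F n) \<le> (\<Sum>x\<in>(UNIV :: (('a \<times> 'a) \<times> ('a \<times> 'a)) set). 3)" for n
  proof -
    have "norm (F n) \<le> (\<Sum>x\<in>UNIV. \<bar>F n $ x\<bar>)" by (rule norm_le_l1_cart)
    also have "\<dots> \<le> (\<Sum>x\<in>(UNIV :: (('a \<times> 'a) \<times> ('a \<times> 'a)) set). 3)"
      unfolding F_def by (rule sum_mono) (rule fourth_moments_bound[OF C \<phi> tr])
    finally show ?thesis .
  qed
  then have "bounded (range F)" unfolding bounded_iff by blast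
  then obtain r D where r: "strict_mono r" and D: "(F \<circ> r) \<longlonglongrightarrow> D"
    using bounded_imp_convergent_subsequence by blast
  have gr: "(\<lambda>n. g (r n)) \<longlonglongrightarrow> G"
    using LIMSEQ_subseq_LIMSEQ[OF gG r] by (simp add: o_def)
  have Fr: "(\<lambda>n. F (r n) $ x) \<longlonglongrightarrow> D $ x" for x
    using tendsto_vec_nth[OF D] by (simp add: o_def)
  have G1: "\<bar>G $ x\<bar> \<le> 1" for x
  proof (rule LIMSEQ_le_const2[OF tendsto_rabs[OF tendsto_vec_nth[OF gG]]])
    show "\<exists>N. \<forall>n\<ge>N. \<bar>g n $ x\<bar> \<le> 1"
      using marginal_bound[OF \<phi>, of _ "fst x" "snd x"] by (simp add: g_def tr)
  qed
  have DG: "D $ ((i, j), x) = G $ (i, j) * G $ x" for i j x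
  proof -
    \<comment> \<open>\<open>H e\<close> is the limit of the renormalised tilts of the
      approximants.\<close>
    define H where "H e = inverse (1 + e * G $ (i, j)) *\<^sub>R (G + e *\<^sub>R (\<chi> x. D $ ((i, j), x)))" for e
    have pos: "0 < 1 + e * G $ (i, j)" if "\<bar>e\<bar> \<le> 1/2" for e
    proof -
      have "\<bar>e * G $ (i, j)\<bar> \<le> (1/2) * 1"
        unfolding abs_mult using that G1 by (intro mult_mono) auto
      then show ?thesis by linarith
    qed
    have H_in: "H e \<in> limit_marginals C" if e: "\<bar>e\<bar> \<le> 1/2" for e
      unfolding limit_marginals_def
    proof (intro INT_I)
      fix m
      define h where "h n = inverse (1 + e * g n $ (i, j)) *\<^sub>R (g n + e *\<^sub>R (\<chi> x. F n $ ((i, j), x)))" for n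
      have "(\<lambda>n. h (r n)) \<longlonglongrightarrow> H e"
        unfolding h_def H_def
      proof (rule tendsto_scaleR)
        show "(\<lambda>n. inverse (1 + e * g (r n) $ (i, j))) \<longlonglongrightarrow> inverse (1 + e * G $ (i, j))"
          using pos[OF e] by (intro tendsto_inverse tendsto_add tendsto_mult tendsto_const tendsto_vec_nth gr) simp
        have "(\<lambda>n. \<chi> x. F (r n) $ ((i, j), x)) \<longlonglongrightarrow> (\<chi> x. D $ ((i, j), x))"
          by (rule vec_tendstoI) (simp add: Fr)
        then show "(\<lambda>n. g (r n) + e *\<^sub>R (\<chi> x. F (r n) $ ((i, j), x))) \<longlonglongrightarrow> G + e *\<^sub>R (\<chi> x. D $ ((i, j), x))"
          by (intro tendsto_add tendsto_scaleR tendsto_const gr)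
      qed
      \<comment> \<open>Only the tail matters: from \<open>r n >= n >= m\<close> on, nestedness puts
        the tilts into the set of level \<open>m\<close>.\<close>
      moreover have "\<forall>\<^sub>F n in sequentially. h (r n) \<in> closure (marginals C m)"
      proof (rule eventually_sequentiallyI[of m])
        fix n assume "m \<le> n"
        then have "m \<le> r n" using seq_suble[OF r, of n] by linarith
        moreover have "h (r n) \<in> marginals C (r n)"
          unfolding h_def g_def F_def by (rule marginals_tilt[OF C \<phi> tr e])
        ultimately show "h (r n) \<in> closure (marginals C m)"
          using marginals_le[OF C] closure_subset by blast
      qed
      ultimately show "H e \<in> closure (marginals C m)"
        by (intro Lim_in_closed_set[of _ "\<lambda>n. h (r n)" sequentially]) auto
    qed
    have scale: "(1 + e * G $ (i, j)) *\<^sub>R H e = G + e *\<^sub>R (\<chi> x. D $ ((i, j), x))" if "\<bar>e\<bar> \<le> 1/2" for e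
      using pos[OF that] by (simp add: H_def)
    \<comment> \<open>The weights \<open>s\<close> and \<open>1 - s\<close> are half the normalisers
      of \<open>H (1/2)\<close> and \<open>H (-1/2)\<close>. In the convex combination the
      normalisers cancel, then the two \<open>D\<close> terms, leaving \<open>G\<close>.\<close>
    define s where "s = (1 + (1/2) * G $ (i, j)) / 2"
    have s: "0 < s" "s < 1"
      using pos[of "1/2"] pos[of "-1/2"] by (auto simp: s_def)
    have s_eqs: "s = (1/2) * (1 + (1/2) * G $ (i, j))" "1 - s = (1/2) * (1 + (-1/2) * G $ (i, j))"
      by (simp_all add: s_def field_simps)
    have "(1 - s) *\<^sub>R H (-1/2) + s *\<^sub>R H (1/2)
       = (1/2) *\<^sub>R ((1 + (-1/2) * G $ (i, j)) *\<^sub>R H (-1/2) + (1 + (1/2) * G $ (i, j)) *\<^sub>R H (1/2))"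
      unfolding s_eqs(2) unfolding s_eqs(1) by (simp only: scaleR_add_right scaleR_scaleR)
    also have "\<dots> = (1/2) *\<^sub>R ((G + (-1/2) *\<^sub>R (\<chi> x. D $ ((i, j), x))) + (G + (1/2) *\<^sub>R (\<chi> x. D $ ((i, j), x))))"
      by (subst (1 2) scale) simp_all
    also have "\<dots> = G" by (simp add: vec_eq_iff)
    finally have comb: "G = (1 - s) *\<^sub>R H (-1/2) + s *\<^sub>R H (1/2)" ..
    \<comment> \<open>\<open>G\<close> would lie strictly between the two points if they differed,
      so both equal \<open>G\<close>; clearing the normaliser then determines
      \<open>D\<close>.\<close>
    have "G \<notin> open_segment (H (-1/2)) (H (1/2))"
      using ext H_in[of "-1/2"] H_in[of "1/2"] by (auto simp: extreme_point_of_def)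
    then have "H (-1/2) = H (1/2)"
      using comb s unfolding in_segment by blast
    then have "G = H (1/2)"
      using comb by (simp add: scaleR_add_left[symmetric])
    then have "(1 + (1/2) * G $ (i, j)) *\<^sub>R G = G + (1/2) *\<^sub>R (\<chi> x. D $ ((i, j), x))"
      using scale[of "1/2"] by simp
    then have "((1 + (1/2) * G $ (i, j)) *\<^sub>R G) $ x = (G + (1/2) *\<^sub>R (\<chi> x. D $ ((i, j), x))) $ x"
      by simp
    then show ?thesis by (simp add: algebra_simps)
  qed
  have "D $ ((i, j), (k, l)) = D $ ((i, k), (j, l))"
  proof (rule LIMSEQ_unique[OF Fr])
    show "(\<lambda>n. F (r n) $ ((i, j), k, l)) \<longlonglongrightarrow> D $ ((i, k), j, l)"
      unfolding F_def fourth_moments_swap[of _ _ i j] using Fr[unfolded F_def] .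
  qed
  then show ?thesis by (simp add: DG)
qed

text \<open>A linear equation cuts out a closed set, so validity at level 0 passes to the limit.
  This carries over both the normalisation and the constraint.\<close>

lemma limit_marginals_linear_eq:
  fixes h :: "real^('a::finite \<times> 'a) \<Rightarrow> 'c::real_normed_vector"
  assumes "linear h" "\<And>G. G \<in> marginals C 0 \<Longrightarrow> h G = c" "G \<in> limit_marginals C"
  shows "h G = c"
proof -
  have "continuous_on UNIV h"
    using assms(1) by (simp add: linear_conv_bounded_linear linear_continuous_on)
  then have "closed {G. h G = c}"
    by (simp add: closed_Collect_eq)
  then have "closure (marginals C 0) \<subseteq> {G. h G = c}"
    using assms(2) by (intro closure_minimal) auto
  then show ?thesis using assms(3) by (auto simp: limit_marginals_def)
qed

text \<open>At level 0 the only tuple is empty, so the marginal is itself a slice.\<close>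

lemma marginals_0_constraint: "G \<in> marginals C 0 \<Longrightarrow> C G = 0"
  by (auto simp: marginals_def moment_form_def marginal_def sum_tuples_0)

definition outer :: "('a \<Rightarrow> real) \<Rightarrow> real^('a::finite \<times> 'a)" where
  "outer y = (\<chi> x. y (fst x) * y (snd x))"

text \<open>Trace 1 provides a positive entry \<open>G_ii\<close>, and
  \<open>G_ii G_kl = G_ik G_il\<close> makes row \<open>i\<close>, divided by
  \<open>sqrt G_ii\<close>, the required vector.\<close>

lemma extreme_limit_marginal_outer:
  assumes C: "linear C" and ext: "G extreme_point_of limit_marginals C"
  obtains y where "G = outer y"
proof -
  have G: "G \<in> limit_marginals C" using ext by (auto simp: extreme_point_of_def)
  have tr: "diag_sum G = 1"
    by (rule limit_marginals_linear_eq[OF linear_diag_sum _ G]) (auto simp: marginals_def)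
  then obtain i where i: "0 < G $ (i, i)"
    unfolding diag_sum_def by (metis (no_types, lifting) not_less sum_nonpos zero_less_one linorder_not_le)
  have "G = outer (\<lambda>k. G $ (i, k) / sqrt (G $ (i, i)))"
    using i extreme_limit_marginal_multiplicative[OF C ext, of i i]
    by (auto simp: vec_eq_iff outer_def field_simps)
  then show ?thesis by (rule that)
qed

text \<open>Compactness turns the bound \<open>c\<close> at every level into a bound at a limit
  point, and some maximiser over the limit set is an extreme point, hence of the form
  \<open>outer y\<close>.\<close>

lemma marginals_hierarchy_limit:
  assumes C: "linear C" and ne: "\<And>n. \<exists>G\<in>marginals C n. c \<le> a \<bullet> G"
  obtains y where "diag_sum (outer y) = 1" "C (outer y) = 0" "c \<le> a \<bullet> outer y"
proof -
  \<comment> \<open>Cutting with the halfspace keeps the sets compact, nested and nonempty.\<close>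
  define K where "K n = closure (marginals C n) \<inter> {G. c \<le> a \<bullet> G}" for n
  have "\<Inter>(range K) \<noteq> {}"
  proof (rule compact_nest)
    show "compact (K n)" for n
      unfolding K_def
      by (intro compact_Int_closed compact_closure_marginals closed_halfspace_ge)
    show "K n \<noteq> {}" for n
      using ne[of n] closure_subset unfolding K_def by fastforce
    show "m \<le> n \<Longrightarrow> K n \<subseteq> K m" for m n
      using closure_mono[OF marginals_le[OF C]] by (auto simp: K_def)
  qed
  then obtain G0 where G0: "G0 \<in> limit_marginals C" "c \<le> a \<bullet> G0"
    by (auto simp: K_def limit_marginals_def)
  have "continuous_on (limit_marginals C) (\<lambda>G. a \<bullet> G)"
    by (intro continuous_intros)
  then obtain G1 where G1: "G1 \<in> limit_marginals C" "\<And>G. G \<in> limit_marginals C \<Longrightarrow> a \<bullet> G \<le> a \<bullet> G1"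
    using continuous_attains_sup[OF compact_limit_marginals, of C "\<lambda>G. a \<bullet> G"] G0(1) by blast
  \<comment> \<open>The maximisers form a compact face, and an extreme point of a face is extreme in
    the whole set.\<close>
  define S where "S = limit_marginals C \<inter> {G. a \<bullet> G = a \<bullet> G1}"
  have face: "S face_of limit_marginals C"
    unfolding S_def by (intro face_of_Int_supporting_hyperplane_le convex_limit_marginals C G1(2))
  have "compact S"
    unfolding S_def by (intro compact_Int_closed compact_limit_marginals closed_hyperplane)
  then obtain G where "G extreme_point_of S"
    using extreme_point_exists_convex[OF _ face_of_imp_convex[OF face]] G1(1) by (auto simp: S_def)
  then have G: "G extreme_point_of limit_marginals C" "G \<in> S"
    using extreme_point_of_face[OF face] by auto
  obtain y where y: "G = outer y"
    using extreme_limit_marginal_outer[OF C G(1)] .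
  have GL: "G \<in> limit_marginals C" using G(2) by (simp add: S_def)
  show ?thesis
  proof
    show "diag_sum (outer y) = 1"
      unfolding y[symmetric]
      by (rule limit_marginals_linear_eq[OF linear_diag_sum _ GL]) (auto simp: marginals_def)
    show "C (outer y) = 0"
      unfolding y[symmetric]
      by (rule limit_marginals_linear_eq[OF C _ GL]) (rule marginals_0_constraint)
    show "c \<le> a \<bullet> outer y"
      using G0 G1(2)[OF G0(1)] G(2) y by (simp add: S_def)
  qed
qed

section \<open>Factorising positive semidefinite matrices of bounded rank\<close>

lemma psd_mat_nth_form:
  assumes "psd_mat (A :: real^'n^'n)"
  shows "0 \<le> (\<Sum>p\<in>UNIV. \<Sum>q\<in>UNIV. u p * u q * A $ p $ q)"
proof -
  have "0 \<le> (\<chi> p. u p) \<bullet> (A *v (\<chi> p. u p))" using assms by (simp add: psd_mat_def)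
  also have "\<dots> = (\<Sum>p\<in>UNIV. \<Sum>q\<in>UNIV. u p * u q * A $ p $ q)"
    by (simp add: inner_vec_def matrix_vector_mult_def sum_distrib_left mult_ac)
  finally show ?thesis .
qed

lemma symmetric_matrix_nth: "transpose A = A \<Longrightarrow> A $ p $ q = A $ q $ p"
  by (metis transpose_def vec_lambda_beta)

text \<open>Without a positive diagonal entry the trace is at most 0, and it bounds every
  entry.\<close>

lemma psd_mat_diag_pos:
  assumes "psd_mat (A :: real^'n^'n)" "A \<noteq> 0"
  obtains i where "0 < A $ i $ i"
proof (rule ccontr)
  assume "\<not> thesis"
  then have "A $ i $ i \<le> 0" for i using that by (meson not_less)
  then have *: "(\<Sum>p\<in>UNIV. A $ p $ p) \<le> 0" by (intro sum_nonpos) auto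
  have "\<bar>A $ i $ j\<bar> \<le> (\<Sum>p\<in>UNIV. A $ p $ p)" for i j
    using assms(1) by (intro quadratic_form_entry_bound[of "\<lambda>p q. A $ p $ q"] psd_mat_nth_form)
      (auto simp: psd_mat_def intro: symmetric_matrix_nth)
  then have "A $ i $ j = 0" for i j using * by (meson abs_le_zero_iff order_trans)
  then show False using assms(2) by (simp add: vec_eq_iff)
qed

text \<open>Subtracting the normalised column of a positive diagonal entry (Schur complement)
  preserves positivity and strictly shrinks the range.\<close>

lemma psd_mat_rank_decomposition:
  assumes "psd_mat (A :: real^'n^'n)" "rank A \<le> m"
  shows "\<exists>z :: nat \<Rightarrow> real^'n. \<forall>p q. A $ p $ q = (\<Sum>a<m. z a $ p * z a $ q)"
  using assms
proof (induction m arbitrary: A)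
  case 0
  show ?case
  proof (cases "A = 0")
    case False
    then have "range ((*v) A) \<noteq> {0}"
      by (metis matrix_eq matrix_vector_mult_0 rangeI singletonD)
    moreover have "dim (range ((*v) A)) = 0"
      using 0 by (simp add: rank_dim_range)
    ultimately show ?thesis
      by (metis dim_eq_0 empty_not_UNIV image_is_empty subset_singletonD)
  qed simp
next
  case (Suc m)
  show ?case
  proof (cases "A = 0")
    case True
    then show ?thesis by (intro exI[of _ "\<lambda>_. 0"]) simp
  next
    case False
    then obtain i where i: "0 < A $ i $ i" using psd_mat_diag_pos Suc.prems(1) by blast
    have sym: "A $ p $ q = A $ q $ p" for p q
      using Suc.prems(1) by (auto simp: psd_mat_def intro: symmetric_matrix_nth)
    define r where "r = A *v axis i 1"
    have r: "r $ p = A $ i $ p" for p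
      using sym[of p i] by (simp add: r_def matrix_vector_mult_basis column_def)
    define B where "B = (\<chi> p q. A $ p $ q - r $ p * r $ q / r $ i)"
    \<comment> \<open>\<open>w x\<close> changes coordinate \<open>i\<close> so that the image under
      \<open>A\<close> vanishes there; \<open>B\<close> is \<open>A\<close> composed with
      \<open>w\<close>.\<close>
    define w where "w x = x - ((r \<bullet> x) / r $ i) *\<^sub>R axis i 1" for x
    have Bw: "B *v x = A *v w x" for x
    proof -
      have "B *v x = A *v x - ((r \<bullet> x) / r $ i) *\<^sub>R r"
        by (simp add: vec_eq_iff B_def matrix_vector_mult_def inner_vec_def
            sum_subtractf sum_distrib_left sum_divide_distrib algebra_simps)
      then show ?thesis
        by (simp add: w_def r_def matrix_vector_mult_diff_distrib matrix_vector_mult_scaleR)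
    qed
    have Bi: "(B *v x) $ i = 0" for x
      using i r by (simp add: B_def matrix_vector_mult_def)
    have "psd_mat B"
      unfolding psd_mat_def
    proof (intro conjI allI)
      show "transpose B = B"
        using sym by (simp add: B_def transpose_def vec_eq_iff mult.commute)
      fix v
      \<comment> \<open>\<open>v - w v\<close> is a multiple of \<open>axis i 1\<close>, which is
        orthogonal to the range of \<open>B\<close>.\<close>
      have "v \<bullet> (B *v v) = w v \<bullet> (A *v w v) + ((r \<bullet> v) / r $ i) * (axis i 1 \<bullet> (B *v v))"
        unfolding Bw[symmetric] by (simp add: w_def inner_diff_left)
      also have "axis i 1 \<bullet> (B *v v) = 0"
        using Bi by (simp add: inner_axis')
      finally show "0 \<le> v \<bullet> (B *v v)"
        using Suc.prems(1) by (simp add: psd_mat_def)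
    qed
    moreover have "rank B \<le> m"
    proof -
      \<comment> \<open>The vector \<open>r\<close> separates the ranges: its coordinate
        \<open>i\<close> is nonzero, while all of the range of \<open>B\<close> vanishes
        there.\<close>
      have "range ((*v) B) \<subseteq> range ((*v) A)" using Bw by auto
      moreover have "r \<in> range ((*v) A)" by (simp add: r_def)
      moreover have "r $ i \<noteq> 0" using i r by simp
      then have "r \<notin> range ((*v) B)" using Bi by auto
      ultimately have "range ((*v) B) \<subset> range ((*v) A)" by blast
      moreover have "span (range ((*v) C)) = range ((*v) C)" for C :: "real^'n^'n"
        by (simp add: linear_subspace_image span_eq_iff)
      ultimately have "dim (range ((*v) B)) < dim (range ((*v) A))"
        by (metis dim_psubset)
      then show ?thesis using Suc.prems(2) by (simp add: rank_dim_range)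
    qed
    ultimately obtain z where z: "\<And>p q. B $ p $ q = (\<Sum>a<m. z a $ p * z a $ q)"
      using Suc.IH by blast
    have "A $ p $ q = (\<Sum>a<Suc m. (z(m := inverse (sqrt (r $ i)) *\<^sub>R r)) a $ p *
        (z(m := inverse (sqrt (r $ i)) *\<^sub>R r)) a $ q)" for p q
    proof -
      have "A $ p $ q = B $ p $ q + r $ p * r $ q / r $ i" by (simp add: B_def)
      moreover have "inverse (sqrt (r $ i)) * r $ p * (inverse (sqrt (r $ i)) * r $ q) = r $ p * r $ q / r $ i"
        using i r by (simp add: field_simps)
      ultimately show ?thesis by (simp add: z)
    qed
    then show ?thesis by blast
  qed
qed

text \<open>Purification: the rank-one factors become the slices of a single vector on the enlarged
  index set, one for each element of \<open>'k\<close>.\<close>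

lemma psd_mat_eq_ptrace2:
  assumes "psd_mat (A :: real^'n::finite^'n)" "rank A \<le> CARD('k::finite)"
  obtains y :: "'n::finite \<times> 'k::finite \<Rightarrow> real" where "A = ptrace2 (\<lambda>p q. y p * y q)"
proof -
  obtain z :: "nat \<Rightarrow> real^'n" where z: "\<And>p q. A $ p $ q = (\<Sum>a<CARD('k). z a $ p * z a $ q)"
    using psd_mat_rank_decomposition[OF assms] by blast
  obtain h :: "'k \<Rightarrow> nat" where "bij_betw h UNIV {0..<CARD('k)}"
    using ex_bij_betw_finite_nat[of "UNIV :: 'k set"] by auto
  then have "bij_betw h UNIV {..<CARD('k)}" by (simp add: lessThan_atLeast0)
  then have "A $ p $ q = (\<Sum>a\<in>UNIV. z (h a) $ p * z (h a) $ q)" for p q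
    unfolding z by (rule sum.reindex_bij_betw[symmetric])
  then have "A = ptrace2 (\<lambda>p q. z (h (snd p)) $ fst p * z (h (snd q)) $ fst q)"
    by (simp add: ptrace2_def vec_eq_iff)
  then show ?thesis by (rule that)
qed

text \<open>The reduced matrix is \<open>Z ** transpose Z\<close> for a matrix \<open>Z\<close> with
  \<open>CARD('k)\<close> columns.\<close>

lemma ptrace2_outer_psd_rank:
  fixes y :: "'n::finite \<times> 'k::finite \<Rightarrow> real"
  shows "psd_mat (ptrace2 (\<lambda>p q. y p * y q))" "rank (ptrace2 (\<lambda>p q. y p * y q)) \<le> CARD('k)"
proof -
  define Z :: "real^'k^'n" where "Z = (\<chi> i a. y (i, a))"
  have eq: "ptrace2 (\<lambda>p q. y p * y q) = Z ** transpose Z"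
    by (simp add: ptrace2_def Z_def matrix_matrix_mult_def transpose_def)
  have "v \<bullet> (Z *v (transpose Z *v v)) = (transpose Z *v v) \<bullet> (transpose Z *v v)" for v
    by (metis dot_lmul_matrix inner_commute transpose_matrix_vector)
  then show "psd_mat (ptrace2 (\<lambda>p q. y p * y q))"
    by (simp add: eq psd_mat_def matrix_transpose_mul flip: matrix_vector_mul_assoc)
  show "rank (ptrace2 (\<lambda>p q. y p * y q)) \<le> CARD('k)"
    unfolding eq using rank_mul_le_left[of Z "transpose Z"] rank_bound[of Z] by linarith
qed

section \<open>Feasible points of the semidefinite programs are moment functionals\<close>

text \<open>Inverting permutations injects one index set into the other; exchanging the roles
  upgrades the inequality to equality.\<close>

lemma sym_proj_commute_le:
  assumes "length xs = N" "length ys = N"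
  shows "sym_proj N xs ys \<le> sym_proj N ys xs"
proof -
  have "card {\<sigma>. \<sigma> permutes {..<N} \<and> xs = permute_list \<sigma> ys}
     \<le> card {\<sigma>. \<sigma> permutes {..<N} \<and> ys = permute_list \<sigma> xs}"
  proof (rule card_inj_on_le[where f = inv])
    show "inj_on inv {\<sigma>. \<sigma> permutes {..<N} \<and> xs = permute_list \<sigma> ys}"
      by (auto simp: inj_on_def) (metis permutes_inv_inv)
    show "inv ` {\<sigma>. \<sigma> permutes {..<N} \<and> xs = permute_list \<sigma> ys}
        \<subseteq> {\<sigma>. \<sigma> permutes {..<N} \<and> ys = permute_list \<sigma> xs}"
    proof clarify
      fix \<sigma> assume \<sigma>: "\<sigma> permutes {..<N}" and "xs = permute_list \<sigma> ys"
      then have "permute_list (inv \<sigma>) (permute_list \<sigma> ys) = permute_list (\<sigma> \<circ> inv \<sigma>) ys"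
        using assms by (intro permute_list_compose[symmetric]) (simp add: permutes_inv)
      then show "inv \<sigma> permutes {..<N} \<and> ys = permute_list (inv \<sigma>) (permute_list \<sigma> ys)"
        using \<sigma> by (simp add: permutes_inv permutes_inv_o)
    qed
    show "finite {\<sigma>. \<sigma> permutes {..<N} \<and> ys = permute_list \<sigma> xs}"
      by (rule finite_subset[OF _ finite_permutations[of "{..<N}"]]) auto
  qed
  then show ?thesis by (simp add: sym_proj_def divide_right_mono)
qed

lemma sym_proj_commute:
  "length xs = N \<Longrightarrow> length ys = N \<Longrightarrow> sym_proj N xs ys = sym_proj N ys xs"
  by (rule antisym) (simp_all add: sym_proj_commute_le)

text \<open>Composing with a permutation that takes \<open>xs\<close> to \<open>xs'\<close> is
  injective, so entries of the projector see only multisets.\<close>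

lemma sym_proj_cong_le:
  assumes "length ys = N" "mset xs = mset xs'" "length xs = N"
  shows "sym_proj N xs ys \<le> sym_proj N xs' ys"
proof -
  obtain \<tau> where "\<tau> permutes {..<length xs}" "permute_list \<tau> xs = xs'"
    using assms(2)[symmetric] by (rule mset_eq_permutation)
  then have \<tau>: "\<tau> permutes {..<N}" "permute_list \<tau> xs = xs'"
    using assms(3) by simp_all
  have "card {\<sigma>. \<sigma> permutes {..<N} \<and> xs = permute_list \<sigma> ys}
     \<le> card {\<sigma>. \<sigma> permutes {..<N} \<and> xs' = permute_list \<sigma> ys}"
  proof (rule card_inj_on_le[where f = "\<lambda>\<sigma>. \<sigma> \<circ> \<tau>"])
    show "inj_on (\<lambda>\<sigma>. \<sigma> \<circ> \<tau>) {\<sigma>. \<sigma> permutes {..<N} \<and> xs = permute_list \<sigma> ys}"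
    proof (rule inj_onI)
      fix a b :: "nat \<Rightarrow> nat" assume "a \<circ> \<tau> = b \<circ> \<tau>"
      then have "a \<circ> (\<tau> \<circ> inv \<tau>) = b \<circ> (\<tau> \<circ> inv \<tau>)" by (simp only: o_assoc)
      then show "a = b" by (simp add: permutes_inv_o[OF \<tau>(1)])
    qed
    show "(\<lambda>\<sigma>. \<sigma> \<circ> \<tau>) ` {\<sigma>. \<sigma> permutes {..<N} \<and> xs = permute_list \<sigma> ys}
        \<subseteq> {\<sigma>. \<sigma> permutes {..<N} \<and> xs' = permute_list \<sigma> ys}"
    proof clarify
      fix \<sigma> assume \<sigma>: "\<sigma> permutes {..<N}" and "xs = permute_list \<sigma> ys"
      moreover have "permute_list (\<sigma> \<circ> \<tau>) ys = permute_list \<tau> (permute_list \<sigma> ys)"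
        using \<tau>(1) assms(1) by (intro permute_list_compose) simp
      ultimately show "\<sigma> \<circ> \<tau> permutes {..<N} \<and> xs' = permute_list (\<sigma> \<circ> \<tau>) ys"
        using permutes_compose[OF \<tau>(1) \<sigma>] \<tau>(2) by simp
    qed
    show "finite {\<sigma>. \<sigma> permutes {..<N} \<and> xs' = permute_list \<sigma> ys}"
      by (rule finite_subset[OF _ finite_permutations[of "{..<N}"]]) auto
  qed
  then show ?thesis by (simp add: sym_proj_def divide_right_mono)
qed

lemma sym_proj_cong:
  assumes "length ys = N" "mset xs = mset xs'" "length xs = N"
  shows "sym_proj N xs ys = sym_proj N xs' ys"
proof (rule antisym)
  show "sym_proj N xs ys \<le> sym_proj N xs' ys" by (rule sym_proj_cong_le[OF assms])
  show "sym_proj N xs' ys \<le> sym_proj N xs ys"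
    using assms mset_eq_length[OF assms(2)] by (intro sym_proj_cong_le) auto
qed

text \<open>The projector averages over rearrangements and so fixes a function that is constant on
  them.\<close>

lemma sum_sym_proj_right:
  fixes g :: "'a::finite list \<Rightarrow> real"
  assumes xs: "length xs = N" and g: "\<And>l. mset l = mset xs \<Longrightarrow> g l = g xs"
  shows "(\<Sum>l\<in>tuples N. g l * sym_proj N l xs) = g xs"
proof -
  let ?S = "{\<sigma>. \<sigma> permutes {..<N}}"
  have fin: "finite ?S" by (simp add: finite_permutations)
  have "sym_proj N l xs = (\<Sum>\<sigma>\<in>?S. of_bool (l = permute_list \<sigma> xs)) / fact N" for l
  proof -
    have "{\<sigma>. \<sigma> permutes {..<N} \<and> l = permute_list \<sigma> xs} = ?S \<inter> {\<sigma>. l = permute_list \<sigma> xs}" by auto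
    moreover have "(\<Sum>\<sigma>\<in>?S. of_bool (l = permute_list \<sigma> xs)) = real (card (?S \<inter> {\<sigma>. l = permute_list \<sigma> xs}))"
      using fin by (simp only: sum_of_bool_eq)
    ultimately show ?thesis by (simp only: sym_proj_def)
  qed
  then have "(\<Sum>l\<in>tuples N. g l * sym_proj N l xs)
      = (\<Sum>l\<in>tuples N. \<Sum>\<sigma>\<in>?S. g l * of_bool (l = permute_list \<sigma> xs)) / fact N"
    by (simp only: sum_distrib_left sum_divide_distrib times_divide_eq_right)
  also have "\<dots> = (\<Sum>\<sigma>\<in>?S. \<Sum>l\<in>tuples N. g l * of_bool (l = permute_list \<sigma> xs)) / fact N"
    by (rule arg_cong[where f = "\<lambda>x. x / fact N"]) (rule sum.swap)
  also have "\<dots> = (\<Sum>\<sigma>\<in>?S. g xs) / fact N"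
  proof (rule arg_cong[where f = "\<lambda>x. x / fact N"], rule sum.cong[OF refl])
    fix \<sigma> assume "\<sigma> \<in> ?S"
    then have "g (permute_list \<sigma> xs) = g xs" using xs by (intro g) simp
    moreover have "permute_list \<sigma> xs \<in> tuples N" using xs by (simp add: tuples_def)
    moreover have "(\<Sum>l\<in>tuples N. g l * of_bool (l = permute_list \<sigma> xs))
        = (\<Sum>l\<in>tuples N. if l = permute_list \<sigma> xs then g l else 0)"
      by (intro sum.cong) auto
    ultimately show "(\<Sum>l\<in>tuples N. g l * of_bool (l = permute_list \<sigma> xs)) = g xs"
      by simp
  qed
  also have "\<dots> = g xs"
    by (simp add: card_permutations)
  finally show ?thesis .
qed

lemma sum_sym_proj_left:
  fixes g :: "'a::finite list \<Rightarrow> real"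
  assumes xs: "length xs = N" and g: "\<And>l. mset l = mset xs \<Longrightarrow> g l = g xs"
  shows "(\<Sum>l\<in>tuples N. sym_proj N xs l * g l) = g xs"
proof -
  have "(\<Sum>l\<in>tuples N. sym_proj N xs l * g l) = (\<Sum>l\<in>tuples N. g l * sym_proj N l xs)"
    using xs by (intro sum.cong) (auto simp: tuples_def sym_proj_commute)
  also have "\<dots> = g xs" by (rule sum_sym_proj_right) fact+
  finally show ?thesis .
qed

text \<open>The arguments enter the projected \<open>\<Phi>\<close> only through entries of the
  projector, which depend on multisets alone.\<close>

lemma sym_proj_invariant:
  fixes \<Phi> :: "'a::finite list \<Rightarrow> 'a list \<Rightarrow> real"
  assumes "ceq (tuples N) (cmult (tuples N) (cmult (tuples N) (sym_proj N) \<Phi>) (sym_proj N)) \<Phi>"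
    and len: "length xs = N" "length ys = N" and eq: "mset xs = mset xs'" "mset ys = mset ys'"
  shows "\<Phi> xs ys = \<Phi> xs' ys'"
proof -
  have \<Phi>: "\<Phi> xs ys = (\<Sum>m\<in>tuples N. (\<Sum>l\<in>tuples N. sym_proj N xs l * \<Phi> l m) * sym_proj N m ys)"
    if "length xs = N" "length ys = N" for xs ys
    using assms(1) that by (auto simp: ceq_def cmult_def tuples_def)
  have len': "length xs' = N" "length ys' = N"
    using len mset_eq_length[OF eq(1)] mset_eq_length[OF eq(2)] by simp_all
  have "sym_proj N m ys = sym_proj N m ys'" if "m \<in> tuples N" for m
    using that len len' eq(2) sym_proj_cong[of m N ys ys']
    by (simp add: tuples_def sym_proj_commute[of m])
  moreover have "sym_proj N xs l = sym_proj N xs' l" if "l \<in> tuples N" for l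
    using that len eq(1) by (intro sym_proj_cong) (auto simp: tuples_def)
  ultimately show ?thesis
    using len len' by (simp add: \<Phi>)
qed

text \<open>Permuting either side and exchanging one index across the two sides generates
  all permutations of the \<open>2N\<close> indices.\<close>

lemma totally_symmetric:
  fixes \<Phi> :: "'a list \<Rightarrow> 'a list \<Rightarrow> real"
  assumes inv: "\<And>xs ys xs' ys'. length xs = Suc n \<Longrightarrow> length ys = Suc n \<Longrightarrow>
      mset xs = mset xs' \<Longrightarrow> mset ys = mset ys' \<Longrightarrow> \<Phi> xs ys = \<Phi> xs' ys'"
    and swap: "\<And>p q s t. length s = n \<Longrightarrow> length t = n \<Longrightarrow> \<Phi> (p # s) (q # t) = \<Phi> (q # s) (p # t)"
    and "length xs = Suc n" "length ys = Suc n" "length xs' = Suc n"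
    and "mset xs + mset ys = mset xs' + mset ys'"
  shows "\<Phi> xs ys = \<Phi> xs' ys'"
  using assms(3-6)
proof (induction "size (mset xs - mset xs')" arbitrary: xs ys rule: less_induct)
  case less
  note len = less.prems(1-3)
  show ?case
  proof (cases "mset xs = mset xs'")
    case True
    then show ?thesis using less.prems inv by auto
  next
    case False
    \<comment> \<open>Distinct multisets of equal size are not included in each other, so both
      differences are nonempty.\<close>
    have "\<not> mset xs \<subseteq># mset xs'" "\<not> mset xs' \<subseteq># mset xs"
      using False len mset_subset_size[of "mset xs" "mset xs'"] mset_subset_size[of "mset xs'" "mset xs"]
      by (auto simp: subset_mset.le_less)
    then have "mset xs - mset xs' \<noteq> {#}" "mset xs' - mset xs \<noteq> {#}"
      by (simp_all add: Diff_eq_empty_iff_mset)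
    then obtain p q where p: "p \<in># mset xs - mset xs'" and q: "q \<in># mset xs' - mset xs"
      using multiset_nonemptyE by blast
    have pc: "count (mset xs') p < count (mset xs) p" and qc: "count (mset xs) q < count (mset xs') q"
      using p q by (simp_all add: in_diff_count)
    \<comment> \<open>The total count is conserved, so an index lacking in \<open>xs\<close> must
      occur in \<open>ys\<close>.\<close>
    have "count (mset xs) q + count (mset ys) q = count (mset xs') q + count (mset ys') q"
      using less.prems(4) by (metis count_union)
    then have "0 < count (mset ys) q" using qc by linarith
    then have "q \<in># mset ys" by (simp only: count_greater_zero_iff)
    moreover have "p \<in># mset xs" using p by (rule in_diffD)
    ultimately have pq: "p \<in> set xs" "q \<in> set ys" by simp_all
    define s where "s = remove1 p xs"
    define t where "t = remove1 q ys"
    have ms: "mset xs = mset (p # s)" "mset ys = mset (q # t)"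
      using pq by (simp_all add: s_def t_def)
    have lst: "length s = n" "length t = n"
      using pq len by (simp_all add: s_def t_def length_remove1)
    have "\<Phi> xs ys = \<Phi> (p # s) (q # t)" using inv len ms by blast
    also have "\<dots> = \<Phi> (q # s) (p # t)" by (rule swap[OF lst])
    also have "\<dots> = \<Phi> xs' ys'"
    proof (rule less.hyps)
      \<comment> \<open>The exchange removes one surplus \<open>p\<close> and, since
        \<open>q\<close> was lacking, creates no new surplus; the induction measure drops.\<close>
      have "mset (q # s) - mset xs' = (mset xs - mset xs') - {#p#}"
      proof (rule multiset_eqI)
        fix x show "count (mset (q # s) - mset xs') x = count ((mset xs - mset xs') - {#p#}) x"
          using pc qc ms(1) by (cases "p = x") auto
      qed
      then show "size (mset (q # s) - mset xs') < size (mset xs - mset xs')"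
        by (simp only: size_Diff1_less[OF p])
      show "mset (q # s) + mset (p # t) = mset xs' + mset ys'"
        using less.prems(4) ms by (simp add: add_mset_commute)
    qed (use lst len in auto)
    finally show ?thesis .
  qed
qed

lemma multiset_split:
  assumes "size M = a + b"
  obtains s t where "length s = a" "length t = b" "mset s + mset t = M"
proof -
  obtain l where l: "mset l = M" using ex_mset by blast
  then have "length l = a + b" using assms by (metis size_mset)
  then show ?thesis
    using l by (intro that[of "take a l" "drop a l"]) (auto simp flip: mset_append)
qed

lemma symmetric_tensor_multiset:
  fixes \<Phi> :: "'a::finite list \<Rightarrow> 'a list \<Rightarrow> real"
  assumes P: "ceq (tuples (Suc n)) (cmult (tuples (Suc n)) (cmult (tuples (Suc n)) (sym_proj (Suc n)) \<Phi>) (sym_proj (Suc n))) \<Phi>"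
    and T: "ceq (tuples (Suc n)) (ptranspose_A \<Phi>) \<Phi>"
  shows "\<exists>\<phi>. \<forall>xs ys. length xs = Suc n \<longrightarrow> length ys = Suc n \<longrightarrow> \<Phi> xs ys = \<phi> (mset xs + mset ys)"
proof -
  have swap: "\<Phi> (p # s) (q # t) = \<Phi> (q # s) (p # t)" if "length s = n" "length t = n" for p q s t
    using bspec[OF bspec[OF T[unfolded ceq_def], of "p # s"], of "q # t"] that
    by (simp add: ptranspose_A_def tuples_def)
  define R where "R M z \<longleftrightarrow> length (fst z) = Suc n \<and> length (snd z) = Suc n \<and> mset (fst z) + mset (snd z) = M"
    for M and z :: "'a list \<times> 'a list"
  \<comment> \<open>The value is read off at an arbitrarily chosen splitting; total symmetry makes
    the choice immaterial.\<close>
  define \<phi> where "\<phi> M = (let z = SOME z. R M z in \<Phi> (fst z) (snd z))" for M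
  have "\<Phi> xs ys = \<phi> (mset xs + mset ys)" if "length xs = Suc n" "length ys = Suc n" for xs ys
  proof -
    let ?z = "SOME z. R (mset xs + mset ys) z"
    have "R (mset xs + mset ys) (xs, ys)" using that by (simp add: R_def)
    then have "R (mset xs + mset ys) ?z" by (rule someI)
    then have "\<Phi> xs ys = \<Phi> (fst ?z) (snd ?z)"
      unfolding R_def using that
      by (intro totally_symmetric[of n \<Phi> xs ys]) (auto intro: sym_proj_invariant[OF P] swap)
    then show ?thesis by (simp add: \<phi>_def Let_def)
  qed
  then show ?thesis by (intro exI[of _ \<phi>]) simp
qed

text \<open>Scaling \<open>Y\<close> by the trace makes the constraint homogeneous. On the block of
  \<open>\<Phi>\<close> belonging to two tails, this trace is an entry of
  \<open>Tr_A \<Phi>\<close>.\<close>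

definition constraint_map :: "(real^'n^'n \<Rightarrow> real^'m^'m) \<Rightarrow> real^'m^'m
    \<Rightarrow> real^(('n::finite \<times> 'k::finite) \<times> ('n \<times> 'k)) \<Rightarrow> real^'m^'m" where
  "constraint_map \<Lambda> Y G = \<Lambda> (ptrace2 (\<lambda>p q. G $ (p, q))) - diag_sum G *\<^sub>R Y"

lemma linear_constraint_map:
  fixes \<Lambda> :: "real^'n::finite^'n \<Rightarrow> real^'m::finite^'m"
  assumes "linear \<Lambda>"
  shows "linear (constraint_map \<Lambda> Y :: real^(('n \<times> 'k::finite) \<times> ('n \<times> 'k)) \<Rightarrow> _)"
proof (rule linearI)
  fix x y :: "real^(('n \<times> 'k) \<times> ('n \<times> 'k))" and r :: real
  have "ptrace2 (\<lambda>p q. (x + y) $ (p, q)) = ptrace2 (\<lambda>p q. x $ (p, q)) + ptrace2 (\<lambda>p q. y $ (p, q))"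
    "ptrace2 (\<lambda>p q. (r *\<^sub>R x) $ (p, q)) = r *\<^sub>R ptrace2 (\<lambda>p q. x $ (p, q))"
    by (simp_all add: ptrace2_def vec_eq_iff sum.distrib sum_distrib_left)
  then show "constraint_map \<Lambda> Y (x + y) = constraint_map \<Lambda> Y x + constraint_map \<Lambda> Y y"
    "constraint_map \<Lambda> Y (r *\<^sub>R x) = r *\<^sub>R constraint_map \<Lambda> Y x"
    using assms
    by (simp_all add: constraint_map_def linear_add linear_scale linear_add[OF linear_diag_sum]
        linear_scale[OF linear_diag_sum] algebra_simps)
qed

definition objective :: "real^'n^'n \<Rightarrow> real^(('n::finite \<times> 'k::finite) \<times> ('n \<times> 'k))" where
  "objective X = (\<chi> x. tensor_id X (fst x) (snd x))"

definition sdp_feasible :: "(real^'n^'n \<Rightarrow> real^'m^'m) \<Rightarrow> real^'m^'m \<Rightarrow> nat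
    \<Rightarrow> (('n::finite \<times> 'k::finite) list \<Rightarrow> ('n \<times> 'k) list \<Rightarrow> real) \<Rightarrow> bool" where
  "sdp_feasible \<Lambda> Y N \<Phi> \<longleftrightarrow>
      csym (tuples N) \<Phi> \<and>
      cpsd (tuples N) \<Phi> \<and>
      ctrace (tuples N) \<Phi> = 1 \<and>
      ceq (tuples N) (cmult (tuples N) (cmult (tuples N) (sym_proj N) \<Phi>) (sym_proj N)) \<Phi> \<and>
      ceq (tuples N) (ptranspose_A \<Phi>) \<Phi> \<and>
      ceq (UNIV \<times> tuples (N - 1)) (LambdaT_A_id \<Lambda> \<Phi>) (Y_tensor_TrA Y \<Phi>)"

text \<open>Each pair of tails selects one block of the constraint, namely the slice at
  \<open>mset s + mset t\<close>, and every multiset of size \<open>2 * n\<close> splits in this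
  way.\<close>

lemma moment_form_iff:
  fixes \<Phi> :: "('n::finite \<times> 'k::finite) list \<Rightarrow> ('n \<times> 'k) list \<Rightarrow> real"
  assumes \<Phi>: "\<And>xs ys. length xs = Suc n \<Longrightarrow> length ys = Suc n \<Longrightarrow> \<Phi> xs ys = \<phi> (mset xs + mset ys)"
  shows "moment_form (constraint_map \<Lambda> Y) n \<phi> \<longleftrightarrow> cpsd (tuples (Suc n)) \<Phi> \<and>
      ceq (UNIV \<times> tuples n) (LambdaT_A_id \<Lambda> \<Phi>) (Y_tensor_TrA Y \<Phi>)"
proof -
  have "csym (tuples (Suc n)) \<Phi>"
    by (auto simp: csym_def tuples_def \<Phi> add.commute)
  moreover have "(\<Sum>s\<in>tuples (Suc n). \<Sum>t\<in>tuples (Suc n). v s * \<Phi> s t * v t)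
     = (\<Sum>s\<in>tuples (Suc n). \<Sum>t\<in>tuples (Suc n). v s * \<phi> (mset s + mset t) * v t)" for v
    by (intro sum.cong refl) (simp add: tuples_def \<Phi>)
  ultimately have psd: "cpsd (tuples (Suc n)) \<Phi> \<longleftrightarrow>
     (\<forall>v. 0 \<le> (\<Sum>s\<in>tuples (Suc n). \<Sum>t\<in>tuples (Suc n). v s * \<phi> (mset s + mset t) * v t))"
    by (simp add: cpsd_def)
  have "constraint_map \<Lambda> Y (slice \<phi> (mset s + mset t)) = 0 \<longleftrightarrow>
      (\<forall>\<mu> \<nu>. LambdaT_A_id \<Lambda> \<Phi> (\<mu>, s) (\<nu>, t) = Y_tensor_TrA Y \<Phi> (\<mu>, s) (\<nu>, t))"
    if "length s = n" "length t = n" for s t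
    using that by (simp add: constraint_map_def slice_def diag_sum_def LambdaT_A_id_def
        Y_tensor_TrA_def \<Phi> vec_eq_iff add_mset_commute mult.commute)
  then have "(\<forall>M. size M = 2 * n \<longrightarrow> constraint_map \<Lambda> Y (slice \<phi> M) = 0) \<longleftrightarrow>
      ceq (UNIV \<times> tuples n) (LambdaT_A_id \<Lambda> \<Phi>) (Y_tensor_TrA Y \<Phi>)"
    unfolding ceq_def tuples_def
    by (auto simp: mult_2 elim!: multiset_split)
  then show ?thesis by (simp add: moment_form_def psd)
qed

lemma ctrace_eq_diag_sum_marginal:
  fixes \<Phi> :: "'a::finite list \<Rightarrow> 'a list \<Rightarrow> real"
  assumes \<Phi>: "\<And>xs ys. length xs = Suc n \<Longrightarrow> length ys = Suc n \<Longrightarrow> \<Phi> xs ys = \<phi> (mset xs + mset ys)"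
  shows "ctrace (tuples (Suc n)) \<Phi> = diag_sum (marginal n \<phi>)"
proof -
  have "ctrace (tuples (Suc n)) \<Phi> = (\<Sum>s\<in>tuples (Suc n). \<phi> (mset s + mset s))"
    unfolding ctrace_def by (intro sum.cong refl) (simp add: \<Phi> tuples_def)
  then show ?thesis
    by (simp add: sum_tuples_Suc diag_sum_def marginal_nth)
qed

lemma objective_eq_inner_marginal:
  fixes \<Phi> :: "('n::finite \<times> 'k::finite) list \<Rightarrow> ('n \<times> 'k) list \<Rightarrow> real"
  assumes \<Phi>: "\<And>xs ys. length xs = Suc n \<Longrightarrow> length ys = Suc n \<Longrightarrow> \<Phi> xs ys = \<phi> (mset xs + mset ys)"
  shows "ctrace (tuples (Suc n)) (cmult (tuples (Suc n)) (op_A_id (tensor_id X)) \<Phi>)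
     = objective X \<bullet> marginal n \<phi>"
proof -
  let ?M = "tensor_id X :: 'n \<times> 'k \<Rightarrow> _"
  have "ctrace (tuples (Suc n)) (cmult (tuples (Suc n)) (op_A_id ?M) \<Phi>)
     = (\<Sum>p\<in>UNIV. \<Sum>s\<in>tuples n. \<Sum>q\<in>UNIV. \<Sum>t\<in>tuples n. if t = s then ?M p q * \<Phi> (q # t) (p # s) else 0)"
    unfolding ctrace_def cmult_def op_A_id_def sum_tuples_Suc
    by (intro sum.cong refl) auto
  also have "\<dots> = (\<Sum>p\<in>UNIV. \<Sum>s\<in>tuples n. \<Sum>q\<in>UNIV. ?M p q * \<Phi> (q # s) (p # s))"
    by (intro sum.cong refl) simp
  also have "\<dots> = (\<Sum>p\<in>UNIV. \<Sum>s\<in>tuples n. \<Sum>q\<in>UNIV. ?M p q * \<phi> (mset s + mset s + {#p, q#}))"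
    by (intro sum.cong refl) (simp add: \<Phi> tuples_def add_mset_commute)
  also have "\<dots> = (\<Sum>p\<in>UNIV. \<Sum>q\<in>UNIV. ?M p q * marginal n \<phi> $ (p, q))"
    unfolding marginal_nth sum_distrib_left by (rule sum.cong[OF refl]) (rule sum.swap)
  also have "\<dots> = objective X \<bullet> marginal n \<phi>"
    by (simp add: objective_def inner_vec_def sum.cartesian_product case_prod_unfold)
  finally show ?thesis .
qed

text \<open>Dependence on the joint multiset alone makes the matrix invariant under the projector on
  both sides and under exchanging the two heads.\<close>

lemma sdp_feasible_of_moment_form:
  fixes \<phi> :: "('n::finite \<times> 'k::finite) multiset \<Rightarrow> real"
  assumes "moment_form (constraint_map \<Lambda> Y) n \<phi>" "diag_sum (marginal n \<phi>) = 1"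
  shows "sdp_feasible \<Lambda> Y (Suc n) (\<lambda>xs ys. \<phi> (mset xs + mset ys))"
proof -
  let ?\<Phi> = "\<lambda>xs ys. \<phi> (mset xs + mset ys)"
  have "cpsd (tuples (Suc n)) ?\<Phi>" and
    "ceq (UNIV \<times> tuples n) (LambdaT_A_id \<Lambda> ?\<Phi>) (Y_tensor_TrA Y ?\<Phi>)"
    using moment_form_iff[of n ?\<Phi> \<phi> \<Lambda> Y] assms(1) by auto
  moreover have "ctrace (tuples (Suc n)) ?\<Phi> = 1"
    using ctrace_eq_diag_sum_marginal[of n ?\<Phi> \<phi>] assms(2) by simp
  moreover have "ceq (tuples (Suc n)) (cmult (tuples (Suc n)) (cmult (tuples (Suc n)) (sym_proj (Suc n)) ?\<Phi>) (sym_proj (Suc n))) ?\<Phi>"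
    unfolding ceq_def cmult_def
  proof (intro ballI)
    fix xs ys :: "('n \<times> 'k) list" assume len: "xs \<in> tuples (Suc n)" "ys \<in> tuples (Suc n)"
    have "(\<Sum>l\<in>tuples (Suc n). sym_proj (Suc n) xs l * ?\<Phi> l m) = ?\<Phi> xs m" for m
      using len by (intro sum_sym_proj_left) (auto simp: tuples_def)
    then show "(\<Sum>m\<in>tuples (Suc n). (\<Sum>l\<in>tuples (Suc n). sym_proj (Suc n) xs l * ?\<Phi> l m) * sym_proj (Suc n) m ys) = ?\<Phi> xs ys"
      using len sum_sym_proj_right[of ys "Suc n" "\<lambda>m. ?\<Phi> xs m"] by (simp add: tuples_def)
  qed
  moreover have "ceq (tuples (Suc n)) (ptranspose_A ?\<Phi>) ?\<Phi>"
    by (auto simp: ceq_def ptranspose_A_def tuples_def length_Suc_conv add_mset_commute)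
  ultimately show ?thesis
    by (simp add: sdp_feasible_def cpsd_def)
qed

lemma xi_N_eq_Sup_marginals:
  fixes X :: "real^'n::finite^'n" and \<Lambda> :: "real^'n^'n \<Rightarrow> real^'m::finite^'m"
  shows "xi_N X \<Lambda> Y TYPE('k::finite) (Suc n) =
    (SUP G\<in>marginals (constraint_map \<Lambda> Y :: real^(('n \<times> 'k) \<times> ('n \<times> 'k)) \<Rightarrow> _) n. ereal (objective X \<bullet> G))"
proof -
  let ?f = "\<lambda>G :: real^(('n \<times> 'k) \<times> ('n \<times> 'k)). ereal (objective X \<bullet> G)"
  let ?K = "marginals (constraint_map \<Lambda> Y :: real^(('n \<times> 'k) \<times> ('n \<times> 'k)) \<Rightarrow> _) n"
  let ?obj = "\<lambda>\<Phi>. ctrace (tuples (Suc n)) (cmult (tuples (Suc n)) (op_A_id (tensor_id X :: 'n \<times> 'k \<Rightarrow> _)) \<Phi>)"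
  have "{ereal (?obj \<Phi>) | \<Phi>. sdp_feasible \<Lambda> Y (Suc n) \<Phi>}
      = ?f ` ?K"
  proof (intro equalityI subsetI)
    fix z assume "z \<in> {ereal (?obj \<Phi>) | \<Phi>. sdp_feasible \<Lambda> Y (Suc n) \<Phi>}"
    then obtain \<Phi> where z: "z = ereal (?obj \<Phi>)" and feas: "sdp_feasible \<Lambda> Y (Suc n) \<Phi>" by blast
    from feas have P: "ceq (tuples (Suc n)) (cmult (tuples (Suc n)) (cmult (tuples (Suc n)) (sym_proj (Suc n)) \<Phi>) (sym_proj (Suc n))) \<Phi>"
      and T: "ceq (tuples (Suc n)) (ptranspose_A \<Phi>) \<Phi>"
      unfolding sdp_feasible_def by blast+
    obtain \<phi> where "\<forall>xs ys. length xs = Suc n \<longrightarrow> length ys = Suc n \<longrightarrow> \<Phi> xs ys = \<phi> (mset xs + mset ys)"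
      using symmetric_tensor_multiset[OF P T] ..
    note \<phi> = this[rule_format]
    have "moment_form (constraint_map \<Lambda> Y) n \<phi>"
    proof (rule iffD2[OF moment_form_iff])
      show "\<Phi> xs ys = \<phi> (mset xs + mset ys)" if "length xs = Suc n" "length ys = Suc n" for xs ys
        using that by (rule \<phi>)
      show "cpsd (tuples (Suc n)) \<Phi> \<and> ceq (UNIV \<times> tuples n) (LambdaT_A_id \<Lambda> \<Phi>) (Y_tensor_TrA Y \<Phi>)"
        using feas unfolding sdp_feasible_def diff_Suc_1 by blast
    qed
    moreover have "diag_sum (marginal n \<phi>) = 1"
    proof -
      have "ctrace (tuples (Suc n)) \<Phi> = diag_sum (marginal n \<phi>)"
        by (rule ctrace_eq_diag_sum_marginal, rule \<phi>)
      then show ?thesis using feas unfolding sdp_feasible_def by argo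
    qed
    ultimately have "marginal n \<phi> \<in> ?K"
      unfolding marginals_def by (intro CollectI exI[of _ \<phi>] conjI refl)
    moreover have "z = ereal (objective X \<bullet> marginal n \<phi>)"
      unfolding z by (rule arg_cong[where f = ereal], rule objective_eq_inner_marginal, rule \<phi>)
    ultimately show "z \<in> ?f ` ?K"
      by (rule rev_image_eqI)
  next
    fix z assume "z \<in> ?f ` ?K"
    then obtain \<phi> :: "('n \<times> 'k) multiset \<Rightarrow> real" where \<phi>: "z = ereal (objective X \<bullet> marginal n \<phi>)"
      "moment_form (constraint_map \<Lambda> Y) n \<phi>" "diag_sum (marginal n \<phi>) = 1"
      by (auto simp: marginals_def)
    have "z = ereal (?obj (\<lambda>xs ys. \<phi> (mset xs + mset ys)))"
      unfolding \<phi>(1) by (rule arg_cong[where f = ereal], rule objective_eq_inner_marginal[symmetric], rule refl)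
    then show "z \<in> {ereal (?obj \<Phi>) | \<Phi>. sdp_feasible \<Lambda> Y (Suc n) \<Phi>}"
      using sdp_feasible_of_moment_form[OF \<phi>(2,3)]
      by (intro CollectI exI[of _ "\<lambda>xs ys. \<phi> (mset xs + mset ys)"] conjI)
  qed
  then show ?thesis
    by (simp only: xi_N_def sdp_feasible_def)
qed

section \<open>Rank-constrained states\<close>

lemma sum_tuples_prod_mset:
  fixes y :: "'a::finite \<Rightarrow> real"
  shows "(\<Sum>s\<in>tuples n. (prod_mset (image_mset y (mset s)))\<^sup>2) = (\<Sum>p\<in>UNIV. (y p)\<^sup>2) ^ n"
proof (induction n)
  case 0
  show ?case by (simp add: sum_tuples_0)
next
  case (Suc n)
  have "(\<Sum>s\<in>tuples (Suc n). (prod_mset (image_mset y (mset s)))\<^sup>2)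
      = (\<Sum>p\<in>UNIV. (y p)\<^sup>2 * (\<Sum>s\<in>tuples n. (prod_mset (image_mset y (mset s)))\<^sup>2))"
    by (simp add: sum_tuples_Suc power_mult_distrib sum_distrib_left)
  then show ?case by (simp add: Suc.IH sum_distrib_right)
qed

lemma diag_sum_outer: "diag_sum (outer y) = (\<Sum>p\<in>UNIV. (y p)\<^sup>2)"
  by (simp add: diag_sum_def outer_def power2_eq_square)

text \<open>Evaluation at the unit vector \<open>y\<close> is multiplicative: its quadratic form is
  a perfect square and its slices are multiples of \<open>outer y\<close>. It is thus a moment
  functional at every level.\<close>

lemma outer_in_marginals:
  assumes "linear C" "diag_sum (outer y) = 1" "C (outer y) = 0"
  shows "outer y \<in> marginals C n"
proof -
  define \<phi> where "\<phi> M = prod_mset (image_mset y M)" for M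
  have slice: "slice \<phi> M = \<phi> M *\<^sub>R outer y" for M
    by (simp add: slice_def \<phi>_def outer_def vec_eq_iff)
  have add: "\<phi> (M + N) = \<phi> M * \<phi> N" for M N
    by (simp add: \<phi>_def)
  have "(\<Sum>s\<in>tuples (Suc n). \<Sum>t\<in>tuples (Suc n). v s * \<phi> (mset s + mset t) * v t)
      = (\<Sum>s\<in>tuples (Suc n). v s * \<phi> (mset s))\<^sup>2" for v
    by (simp only: add power2_eq_square sum_product mult_ac)
  then have "moment_form C n \<phi>"
    using assms by (simp add: moment_form_def slice linear_scale)
  moreover have "marginal n \<phi> = outer y"
  proof -
    have "marginal n \<phi> = (\<Sum>s\<in>tuples n. (\<phi> (mset s))\<^sup>2) *\<^sub>R outer y"
      unfolding marginal_def slice add by (simp only: scaleR_sum_left power2_eq_square)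
    also have "(\<Sum>s\<in>tuples n. (\<phi> (mset s))\<^sup>2) = 1"
      using assms(2) by (simp add: \<phi>_def sum_tuples_prod_mset diag_sum_outer)
    finally show ?thesis by simp
  qed
  ultimately show ?thesis
    unfolding marginals_def using assms(2) by (intro CollectI exI[of _ \<phi>]) simp
qed

lemma trace_ptrace2_outer: "trace (ptrace2 (\<lambda>p q. y p * y q)) = diag_sum (outer y)"
proof -
  have "trace (ptrace2 (\<lambda>p q. y p * y q)) = (\<Sum>i\<in>UNIV. \<Sum>a\<in>UNIV. y (i, a) * y (i, a))"
    by (simp add: trace_def ptrace2_def)
  also have "\<dots> = (\<Sum>x\<in>UNIV \<times> UNIV. y x * y x)"
    by (simp only: sum.cartesian_product')
  finally show ?thesis
    by (simp add: diag_sum_def outer_def)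
qed

lemma objective_inner_outer:
  fixes y :: "'n::finite \<times> 'k::finite \<Rightarrow> real"
  shows "objective X \<bullet> outer y = trace (X ** ptrace2 (\<lambda>p q. y p * y q))"
proof -
  have "objective X \<bullet> outer y
      = (\<Sum>x\<in>(UNIV \<times> UNIV) \<times> (UNIV \<times> UNIV). tensor_id X (fst x) (snd x) * (y (fst x) * y (snd x)))"
    by (simp add: inner_vec_def objective_def outer_def)
  also have "\<dots> = (\<Sum>i\<in>UNIV. \<Sum>a\<in>UNIV. \<Sum>j\<in>UNIV. \<Sum>b\<in>UNIV. tensor_id X (i, a) (j, b) * (y (i, a) * y (j, b)))"
    by (simp only: sum.cartesian_product' fst_conv snd_conv)
  also have "\<dots> = (\<Sum>i\<in>UNIV. \<Sum>a\<in>UNIV. \<Sum>j\<in>UNIV. \<Sum>b\<in>UNIV. if b = a then X $ i $ j * (y (j, b) * y (i, a)) else 0)"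
    by (intro sum.cong refl) (auto simp: tensor_id_def)
  also have "\<dots> = (\<Sum>i\<in>UNIV. \<Sum>a\<in>UNIV. \<Sum>j\<in>UNIV. X $ i $ j * (y (j, a) * y (i, a)))"
    by simp
  also have "\<dots> = (\<Sum>i\<in>UNIV. \<Sum>j\<in>UNIV. \<Sum>a\<in>UNIV. X $ i $ j * (y (j, a) * y (i, a)))"
    by (rule sum.cong[OF refl]) (rule sum.swap)
  also have "\<dots> = trace (X ** ptrace2 (\<lambda>p q. y p * y q))"
    by (simp add: trace_def matrix_matrix_mult_def ptrace2_def sum_distrib_left)
  finally show ?thesis .
qed

text \<open>The positive semidefinite matrices of rank at most \<open>CARD('k)\<close> are exactly
  the reduced matrices of vectors on the enlarged space; trace 1 becomes unit norm.\<close>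

lemma xi_opt_eq_Sup_outer:
  fixes X :: "real^'n::finite^'n" and \<Lambda> :: "real^'n^'n \<Rightarrow> real^'m::finite^'m"
  shows "xi_opt X \<Lambda> Y CARD('k::finite) = (SUP y\<in>{y :: 'n \<times> 'k \<Rightarrow> real.
      diag_sum (outer y) = 1 \<and> constraint_map \<Lambda> Y (outer y) = 0}. ereal (objective X \<bullet> outer y))"
    (is "_ = Sup (?f ` ?S)")
proof -
  have C: "constraint_map \<Lambda> Y (outer y) = 0 \<longleftrightarrow> \<Lambda> (ptrace2 (\<lambda>p q. y p * y q)) = Y"
    if "diag_sum (outer y) = 1" for y :: "'n \<times> 'k \<Rightarrow> real"
  proof -
    have "ptrace2 (\<lambda>p q. outer y $ (p, q)) = ptrace2 (\<lambda>p q. y p * y q)"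
      by (simp add: outer_def)
    then show ?thesis using that by (simp add: constraint_map_def)
  qed
  have "{ereal (trace (X ** \<rho>)) | \<rho>. \<Lambda> \<rho> = Y \<and> trace \<rho> = 1 \<and> psd_mat \<rho> \<and> rank \<rho> \<le> CARD('k)} = ?f ` ?S"
  proof (intro equalityI subsetI)
    fix z assume "z \<in> {ereal (trace (X ** \<rho>)) | \<rho>. \<Lambda> \<rho> = Y \<and> trace \<rho> = 1 \<and> psd_mat \<rho> \<and> rank \<rho> \<le> CARD('k)}"
    then obtain \<rho> where \<rho>: "z = ereal (trace (X ** \<rho>))" "\<Lambda> \<rho> = Y" "trace \<rho> = 1" "psd_mat \<rho>" "rank \<rho> \<le> CARD('k)"
      by blast
    obtain y :: "'n \<times> 'k \<Rightarrow> real" where y: "\<rho> = ptrace2 (\<lambda>p q. y p * y q)"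
      using psd_mat_eq_ptrace2[OF \<rho>(4,5)] .
    have "diag_sum (outer y) = 1" using \<rho>(3) y by (simp add: trace_ptrace2_outer)
    then have "y \<in> ?S" using C \<rho>(2) y by simp
    moreover have "z = ?f y" using \<rho>(1) y by (simp add: objective_inner_outer)
    ultimately show "z \<in> ?f ` ?S" by (intro image_eqI[where x = y])
  next
    fix z assume "z \<in> ?f ` ?S"
    then obtain y where y: "y \<in> ?S" "z = ?f y" by blast
    let ?\<rho> = "ptrace2 (\<lambda>p q. y p * y q)"
    have "\<Lambda> ?\<rho> = Y" "trace ?\<rho> = 1"
      using y(1) C[of y] by (simp_all add: trace_ptrace2_outer)
    moreover have "z = ereal (trace (X ** ?\<rho>))"
      using y(2) by (simp add: objective_inner_outer)
    ultimately show "z \<in> {ereal (trace (X ** \<rho>)) | \<rho>. \<Lambda> \<rho> = Y \<and> trace \<rho> = 1 \<and> psd_mat \<rho> \<and> rank \<rho> \<le> CARD('k)}"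
      using ptrace2_outer_psd_rank[of y] by (intro CollectI exI[of _ ?\<rho>]) simp
  qed
  then show ?thesis by (simp only: xi_opt_def)
qed

section \<open>Bounds, monotonicity and convergence of the hierarchy\<close>

theorem theorem4:
  fixes X :: "real^'n^'n"
    and \<Lambda> :: "real^'n^'n \<Rightarrow> real^'m^'m"
    and Y :: "real^'m^'m"
  assumes "transpose X = X"
    and "linear \<Lambda>"
  shows "(\<forall>N\<ge>1. xi_opt X \<Lambda> Y CARD('k) \<le> xi_N X \<Lambda> Y TYPE('k::finite) N)
    \<and> (\<forall>N\<ge>1. xi_N X \<Lambda> Y TYPE('k) (N + 1) \<le> xi_N X \<Lambda> Y TYPE('k) N)
    \<and> (\<lambda>N. xi_N X \<Lambda> Y TYPE('k) N) \<longlonglongrightarrow> xi_opt X \<Lambda> Y CARD('k)"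
proof -
  let ?C = "constraint_map \<Lambda> Y :: real^(('n \<times> 'k) \<times> ('n \<times> 'k)) \<Rightarrow> _"
  let ?\<xi> = "xi_opt X \<Lambda> Y CARD('k)"
  \<comment> \<open>Levels start at 0 while the number of parties starts at 1.\<close>
  define \<eta> where "\<eta> n = xi_N X \<Lambda> Y TYPE('k) (Suc n)" for n
  have \<eta>: "\<eta> n = (SUP G\<in>marginals ?C n. ereal (objective X \<bullet> G))" for n
    unfolding \<eta>_def by (rule xi_N_eq_Sup_marginals)
  have C: "linear ?C" using assms(2) by (rule linear_constraint_map)
  have lower: "?\<xi> \<le> \<eta> n" for n
    unfolding \<eta> xi_opt_eq_Sup_outer
  proof (rule SUP_least)
    fix y :: "'n \<times> 'k \<Rightarrow> real"
    assume "y \<in> {y. diag_sum (outer y) = 1 \<and> ?C (outer y) = 0}"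
    then have "outer y \<in> marginals ?C n" using outer_in_marginals[OF C] by blast
    then show "ereal (objective X \<bullet> outer y) \<le> (SUP G\<in>marginals ?C n. ereal (objective X \<bullet> G))"
      by (rule SUP_upper)
  qed
  have mono: "\<eta> (Suc n) \<le> \<eta> n" for n
    unfolding \<eta> using marginals_antimono[OF C] by (rule SUP_subset_mono) simp
  have "(INF n. \<eta> n) \<le> ?\<xi>"
  proof (rule dense_le)
    fix e assume e: "e < (INF n. \<eta> n)"
    show "e \<le> ?\<xi>"
    proof (cases e)
      case (real c)
      have ne: "\<exists>G\<in>marginals ?C n. c \<le> objective X \<bullet> G" for n
      proof -
        have "e < \<eta> n" using e by (rule less_INF_D) simp
        then obtain G where "G \<in> marginals ?C n" "e < ereal (objective X \<bullet> G)"
          unfolding \<eta> less_SUP_iff by blast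
        then show ?thesis using real by (intro bexI[of _ G]) auto
      qed
      obtain y where y: "diag_sum (outer y) = 1" "?C (outer y) = 0" "c \<le> objective X \<bullet> outer y"
        by (rule marginals_hierarchy_limit[OF C ne])
      have "e \<le> ereal (objective X \<bullet> outer y)" using y(3) real by simp
      also have "\<dots> \<le> ?\<xi>"
        unfolding xi_opt_eq_Sup_outer using y(1,2) by (intro SUP_upper) simp
      finally show ?thesis .
    \<comment> \<open>The value \<open>\<infinity>\<close> cannot lie strictly below the infimum,
      and \<open>-\<infinity>\<close> is below everything.\<close>
    qed (use e in auto)
  qed
  then have "(INF n. \<eta> n) = ?\<xi>"
    by (rule antisym) (intro INF_greatest lower)
  moreover have "\<eta> \<longlonglongrightarrow> (INF n. \<eta> n)"
    by (intro LIMSEQ_INF decseq_SucI mono)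
  ultimately have "(\<lambda>n. xi_N X \<Lambda> Y TYPE('k) (Suc n)) \<longlonglongrightarrow> ?\<xi>"
    by (simp only: \<eta>_def[abs_def])
  \<comment> \<open>Undoing the shift adds only the term \<open>N = 0\<close>, which does not affect
    the limit.\<close>
  then have "(\<lambda>N. xi_N X \<Lambda> Y TYPE('k) N) \<longlonglongrightarrow> ?\<xi>"
    by (rule LIMSEQ_imp_Suc)
  moreover have "?\<xi> \<le> xi_N X \<Lambda> Y TYPE('k) N" if "1 \<le> N" for N
    using that lower[of "N - 1"] by (simp add: \<eta>_def)
  moreover have "xi_N X \<Lambda> Y TYPE('k) (N + 1) \<le> xi_N X \<Lambda> Y TYPE('k) N" if "1 \<le> N" for N
    using that mono[of "N - 1"] by (simp add: \<eta>_def)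
  ultimately show ?thesis by blast
qed

end
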